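(* For every topological space $X$, the group homomorphism $h_X:F_R^{P_X}(\pi_0^{top}(X))\to\pi_1^{top}(\Sigma(X_+))$ is a topological isomorphism, i.e. a group isomorphism that is also a homeomorphism.
   Context: For a space $Z$, $\pi_0^{top}(Z)$ is the set $\pi_0(Z)$ of path components of $Z$ with the quotient topology from the canonical map $P_Z:Z\to\pi_0(Z)$. For a based space $(Z,z)$, $\Omega(Z,z)$ is the space of loops $I=[0,1]\to Z$ based at $z$ with the compact-open topology, and $\pi_1^{top}(Z,z)=\pi_0^{top}(\Omega(Z,z))$, i.e. $\pi_1(Z,z)$ with the quotient topology from $\Omega(Z,z)\to\pi_1(Z,z)$. For a space $X$, $X_+=X\sqcup\{*\}$ is $X$ with a disjoint basepoint, and $\Sigma(X_+)=\dfrac{X_+\times I}{X\times\{0,1\}\cup\{*\}\times I}$ is the reduced suspension, with basepoint $x_0$ the image of the collapsed set; $\pi_1^{top}(\Sigma(X_+))$ is based at $x_0$. For $x\in X$ let $u_x:I\to\Sigma(X_+)$ be the loop sending $t$ to the image of $(x,t)$. Let $F(\pi_0(X))$ be the free group on the set $\pi_0(X)$. The homomorphism $h_X:F(\pi_0(X))\to\pi_1(\Sigma(X_+))$ sends the generator $P\in\pi_0(X)$ to the homotopy class $[u_x]$ for any $x\in P$ (this is well defined). For a space $Y$, let $Y^{-1}$ be a homeomorphic copy of $Y$, and let $M_T^*(Y)=\coprod_{n\ge 0}(Y\sqcup Y^{-1})^n$ be the free topological monoid on $Y\sqcup Y^{-1}$ (words under concatenation; the $n=0$ term is the one-point space consisting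 of the empty word $e$). Let $R:M_T^*(Y)\to F(Y)$ be the usual reduction of words, where $F(Y)$ is the free group on the underlying set of $Y$. There is a canonical continuous bijection $\psi_X:\pi_0^{top}(M_T^*(X))\to M_T^*(\pi_0^{top}(X))$ sending the path component of a word $x_1^{\epsilon_1}\cdots x_n^{\epsilon_n}$ to the word $P_X(x_1)^{\epsilon_1}\cdots P_X(x_n)^{\epsilon_n}$. $F_R^{P_X}(\pi_0^{top}(X))$ denotes the free group $F(\pi_0(X))$ with the quotient topology with respect to the composite $R\circ\psi_X:\pi_0^{top}(M_T^*(X))\to M_T^*(\pi_0^{top}(X))\to F(\pi_0(X))$. *)

theory Defs
  imports "HOL-Analysis.Analysis" "HOL-Algebra.Group"
begin

section \<open>Quotient topologies and the path component space\<close>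

text \<open>The quotient topology with respect to \<open>f\<close>, on the image of \<open>f\<close>.\<close>

definition quotient_topology :: "'a topology \<Rightarrow> ('a \<Rightarrow> 'b) \<Rightarrow> 'b topology" where
  "quotient_topology X f =
     topology (\<lambda>U. U \<subseteq> f ` topspace X \<and> openin X {x \<in> topspace X. f x \<in> U})"

lemma openin_quotient_topology:
  "openin (quotient_topology X f) U \<longleftrightarrow>
     U \<subseteq> f ` topspace X \<and> openin X {x \<in> topspace X. f x \<in> U}"
proof -
  have "istopology (\<lambda>U. U \<subseteq> f ` topspace X \<and> openin X {x \<in> topspace X. f x \<in> U})"
    unfolding istopology_def
  proof (intro conjI allI impI)
    fix S T
    assume S: "S \<subseteq> f ` topspace X \<and> openin X {x \<in> topspace X. f x \<in> S}"
      and T: "T \<subseteq> f ` topspace X \<and> openin X {x \<in> topspace X. f x \<in> T}"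
    show "S \<inter> T \<subseteq> f ` topspace X" using S by blast
    have "{x \<in> topspace X. f x \<in> S \<inter> T} = {x \<in> topspace X. f x \<in> S} \<inter> {x \<in> topspace X. f x \<in> T}"
      by blast
    then show "openin X {x \<in> topspace X. f x \<in> S \<inter> T}" using S T by auto
  next
    fix \<K>
    assume K: "\<forall>K\<in>\<K>. K \<subseteq> f ` topspace X \<and> openin X {x \<in> topspace X. f x \<in> K}"
    show "\<Union>\<K> \<subseteq> f ` topspace X" using K by blast
    have "{x \<in> topspace X. f x \<in> \<Union>\<K>} = (\<Union>K\<in>\<K>. {x \<in> topspace X. f x \<in> K})"
      by blast
    then show "openin X {x \<in> topspace X. f x \<in> \<Union>\<K>}" using K by auto
  qed
  then show ?thesis by (simp add: quotient_topology_def)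
qed

lemma topspace_quotient_topology [simp]: "topspace (quotient_topology X f) = f ` topspace X"
proof -
  have "{x \<in> topspace X. f x \<in> f ` topspace X} = topspace X" by blast
  then have "openin (quotient_topology X f) (f ` topspace X)"
    by (simp add: openin_quotient_topology)
  moreover have "topspace (quotient_topology X f) \<subseteq> f ` topspace X"
    using openin_quotient_topology[of X f] openin_topspace by blast
  ultimately show ?thesis
    using openin_subset by blast
qed

lemma quotient_map_quotient_topology: "quotient_map X (quotient_topology X f) f"
  by (auto simp: quotient_map_def openin_quotient_topology)

lemma quotient_topology_cong:
  assumes "\<And>x. x \<in> topspace X \<Longrightarrow> f x = g x"
  shows "quotient_topology X f = quotient_topology X g"
proof (rule topology_eq[THEN iffD2], intro allI)
  fix U
  have "f ` topspace X = g ` topspace X"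
    "{x \<in> topspace X. f x \<in> U} = {x \<in> topspace X. g x \<in> U}"
    using assms by auto
  then show "openin (quotient_topology X f) U = openin (quotient_topology X g) U"
    by (simp add: openin_quotient_topology)
qed

definition pi0_top :: "'a topology \<Rightarrow> 'a set topology" where
  "pi0_top Z = quotient_topology Z (path_component_of_set Z)"

lemma topspace_pi0_top [simp]: "topspace (pi0_top Z) = path_components_of Z"
  by (simp add: pi0_top_def path_components_of_def)


section \<open>Loop spaces and the topologized fundamental group\<close>

text \<open>Continuous maps are taken extensional, so that they are determined by their values on
  the domain.\<close>

definition compact_open_topology :: "'a topology \<Rightarrow> 'b topology \<Rightarrow> ('a \<Rightarrow> 'b) topology" where
  "compact_open_topology X Y =
     topology_generated_by
       {{f \<in> extensional (topspace X). continuous_map X Y f \<and> f ` K \<subseteq> U} | K U.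
          compactin X K \<and> openin Y U}"

definition loop_space :: "'a topology \<Rightarrow> 'a \<Rightarrow> (real \<Rightarrow> 'a) topology" where
  "loop_space Z z =
     subtopology (compact_open_topology (top_of_set {0..1}) Z) {p. p 0 = z \<and> p 1 = z}"

lemma topspace_compact_open_topology [simp]:
  "topspace (compact_open_topology X Y) = {f \<in> extensional (topspace X). continuous_map X Y f}"
proof -
  let ?C = "{f \<in> extensional (topspace X). continuous_map X Y f}"
  let ?W = "\<lambda>K U. {f \<in> extensional (topspace X). continuous_map X Y f \<and> f ` K \<subseteq> U}"
  have "?C = ?W {} {}" by auto
  then have "?C \<in> {?W K U | K U. compactin X K \<and> openin Y U}"
    using compactin_empty openin_empty by blast
  then have "\<Union>{?W K U | K U. compactin X K \<and> openin Y U} = ?C"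
    by blast
  then show ?thesis
    by (simp only: compact_open_topology_def topology_generated_by_topspace)
qed

lemma topspace_loop_space:
  "topspace (loop_space Z z) =
     {p \<in> extensional {0..1}. pathin Z p \<and> p 0 = z \<and> p 1 = z}"
  by (auto simp: loop_space_def pathin_def)

definition loop_homotopic :: "'a topology \<Rightarrow> 'a \<Rightarrow> (real \<Rightarrow> 'a) \<Rightarrow> (real \<Rightarrow> 'a) \<Rightarrow> bool" where
  "loop_homotopic Z z = homotopic_with (\<lambda>p. p 0 = z \<and> p 1 = z) (top_of_set {0..1}) Z"

definition loop_class :: "'a topology \<Rightarrow> 'a \<Rightarrow> (real \<Rightarrow> 'a) \<Rightarrow> (real \<Rightarrow> 'a) set" where
  "loop_class Z z p = {q \<in> topspace (loop_space Z z). loop_homotopic Z z p q}"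

definition loop_concat :: "(real \<Rightarrow> 'a) \<Rightarrow> (real \<Rightarrow> 'a) \<Rightarrow> real \<Rightarrow> 'a" where
  "loop_concat p q = (\<lambda>t\<in>{0..1}. if t \<le> 1/2 then p (2 * t) else q (2 * t - 1))"

text \<open>In the product, the union is over copies of one and the same class.\<close>

definition pi1 :: "'a topology \<Rightarrow> 'a \<Rightarrow> (real \<Rightarrow> 'a) set monoid" where
  "pi1 Z z =
     \<lparr>carrier = loop_class Z z ` topspace (loop_space Z z),
      mult = (\<lambda>A B. \<Union>p\<in>A. \<Union>q\<in>B. loop_class Z z (loop_concat p q)),
      one = loop_class Z z (\<lambda>t\<in>{0..1}. z)\<rparr>"

definition pi1_top :: "'a topology \<Rightarrow> 'a \<Rightarrow> (real \<Rightarrow> 'a) set topology" where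
  "pi1_top Z z = quotient_topology (loop_space Z z) (loop_class Z z)"

lemma topspace_pi1_top: "topspace (pi1_top Z z) = carrier (pi1 Z z)"
  by (simp add: pi1_top_def pi1_def)


section \<open>Free groups and free topological monoids\<close>

text \<open>A letter is a pair of a sign and an element: \<open>(True, y)\<close> stands for \<open>y\<close> and
  \<open>(False, y)\<close> for its formal inverse.\<close>

fun reduced_word :: "(bool \<times> 'a) list \<Rightarrow> bool" where
  "reduced_word (a # b # w) \<longleftrightarrow> \<not> (snd a = snd b \<and> fst a \<noteq> fst b) \<and> reduced_word (b # w)"
| "reduced_word _ \<longleftrightarrow> True"

fun cons_reduce :: "bool \<times> 'a \<Rightarrow> (bool \<times> 'a) list \<Rightarrow> (bool \<times> 'a) list" where
  "cons_reduce a [] = [a]"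
| "cons_reduce a (b # w) = (if snd a = snd b \<and> fst a \<noteq> fst b then w else a # b # w)"

definition reduce_word :: "(bool \<times> 'a) list \<Rightarrow> (bool \<times> 'a) list" where
  "reduce_word w = foldr cons_reduce w []"

definition free_group :: "'a set \<Rightarrow> (bool \<times> 'a) list monoid" where
  "free_group S =
     \<lparr>carrier = {w \<in> lists (UNIV \<times> S). reduced_word w},
      mult = (\<lambda>u v. reduce_word (u @ v)),
      one = []\<rparr>"

text \<open>\<open>letter_space Y\<close> is the disjoint sum of two copies of \<open>Y\<close>.  The free topological monoid
  is the disjoint sum of its finite powers; \<open>(n, f)\<close> in that sum is identified with the list
  \<open>[f 0, \<dots>, f (n - 1)]\<close>, a bijection onto the words over \<open>letter_space Y\<close>.\<close>

definition letter_space :: "'a topology \<Rightarrow> (bool \<times> 'a) topology" where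
  "letter_space Y = sum_topology (\<lambda>_. Y) UNIV"

definition free_monoid_top :: "'a topology \<Rightarrow> (bool \<times> 'a) list topology" where
  "free_monoid_top Y =
     quotient_topology
       (sum_topology (\<lambda>n. product_topology (\<lambda>_. letter_space Y) {..<n}) UNIV)
       (\<lambda>(n, f). map f [0..<n])"

text \<open>The map \<open>\<psi>\<close> from path components of words to words of path components; its value is the
  common value of the letterwise application of \<open>P\<^sub>X\<close> to the words in the component.\<close>

definition word_components :: "'a topology \<Rightarrow> (bool \<times> 'a) list set \<Rightarrow> (bool \<times> 'a set) list" where
  "word_components X C = the_elem ((map (\<lambda>(e, x). (e, path_component_of_set X x))) ` C)"

definition free_group_top :: "'a topology \<Rightarrow> (bool \<times> 'a set) list topology" where
  "free_group_top X =
     quotient_topology (pi0_top (free_monoid_top X)) (reduce_word \<circ> word_components X)"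


section \<open>The suspension of a space with disjoint base point\<close>

definition plus_topology :: "'a topology \<Rightarrow> 'a option topology" where
  "plus_topology X = topology (\<lambda>U. openin X {x. Some x \<in> U})"

lemma openin_plus_topology: "openin (plus_topology X) U \<longleftrightarrow> openin X {x. Some x \<in> U}"
proof -
  have 1: "{x. Some x \<in> S \<inter> T} = {x. Some x \<in> S} \<inter> {x. Some x \<in> T}" for S T :: "'a option set"
    by blast
  have 2: "{x. Some x \<in> \<Union>\<K>} = (\<Union>K\<in>\<K>. {x. Some x \<in> K})" for \<K> :: "'a option set set"
    by blast
  have "istopology (\<lambda>U. openin X {x. Some x \<in> U})"
    unfolding istopology_def 1 2 by (intro conjI allI impI openin_Int openin_Union) auto
  then show ?thesis by (simp add: plus_topology_def)
qed

lemma topspace_plus_topology [simp]: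
  "topspace (plus_topology X) = insert None (Some ` topspace X)" (is "?L = ?R")
proof
  have "openin X {x. Some x \<in> ?L}" using openin_plus_topology openin_topspace by blast
  then have "{x. Some x \<in> ?L} \<subseteq> topspace X" by (rule openin_subset)
  moreover have "y \<in> insert None (Some ` {x. Some x \<in> ?L})" if "y \<in> ?L" for y
    using that by (cases y) auto
  ultimately show "?L \<subseteq> ?R" by blast
  have "{x. Some x \<in> ?R} = topspace X" by auto
  then have "openin (plus_topology X) ?R" by (simp add: openin_plus_topology)
  then show "?R \<subseteq> ?L" by (rule openin_subset)
qed

text \<open>The set collapsed to a point in the suspension; as a point of the quotient it is the base
  point.\<close>

definition susp_collapsed :: "'a topology \<Rightarrow> ('a option \<times> real) set" where
  "susp_collapsed X = Some ` topspace X \<times> {0, 1} \<union> {None} \<times> {0..1}"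

definition susp_proj :: "'a topology \<Rightarrow> 'a option \<times> real \<Rightarrow> ('a option \<times> real) set" where
  "susp_proj X p = (if p \<in> susp_collapsed X then susp_collapsed X else {p})"

definition suspension_plus :: "'a topology \<Rightarrow> ('a option \<times> real) set topology" where
  "suspension_plus X =
     quotient_topology (prod_topology (plus_topology X) (top_of_set {0..1})) (susp_proj X)"

abbreviation susp_base :: "'a topology \<Rightarrow> ('a option \<times> real) set" where
  "susp_base X \<equiv> susp_collapsed X"

abbreviation susp_pi1 :: "'a topology \<Rightarrow> (real \<Rightarrow> ('a option \<times> real) set) set monoid" where
  "susp_pi1 X \<equiv> pi1 (suspension_plus X) (susp_base X)"

definition susp_loop :: "'a topology \<Rightarrow> 'a \<Rightarrow> real \<Rightarrow> ('a option \<times> real) set" where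
  "susp_loop X x = (\<lambda>t\<in>{0..1}. susp_proj X (Some x, t))"

text \<open>The class \<open>[u\<^sub>x]\<close> for any \<open>x \<in> P\<close>; the union is over copies of one and the same class.\<close>

definition susp_gen :: "'a topology \<Rightarrow> 'a set \<Rightarrow> (real \<Rightarrow> ('a option \<times> real) set) set" where
  "susp_gen X P = (\<Union>x\<in>P. loop_class (suspension_plus X) (susp_base X) (susp_loop X x))"

text \<open>The homomorphism \<open>h\<^sub>X\<close>: the product of the \<open>[u\<^sub>x]\<^sup>\<plusminus>\<^sup>1\<close> along the (reduced) word.\<close>

definition susp_hom ::
    "'a topology \<Rightarrow> (bool \<times> 'a set) list \<Rightarrow> (real \<Rightarrow> ('a option \<times> real) set) set" where
  "susp_hom X w =
     foldr (\<lambda>(e, P) g. (if e then susp_gen X P else inv\<^bsub>susp_pi1 X\<^esub> susp_gen X P) \<otimes>\<^bsub>susp_pi1 X\<^esub> g)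
       w \<one>\<^bsub>susp_pi1 X\<^esub>"


section \<open>Basic facts: the notions above are well defined\<close>

text \<open>Proved below: homotopy classes of loops are the path components of the loop space, so that
  \<open>pi1_top Z z = pi0_top (loop_space Z z)\<close>; \<open>pi1\<close> and \<open>free_group\<close> are groups; \<open>susp_hom\<close> takes
  the generator given by the path component of \<open>x\<close> to \<open>[u\<^sub>x]\<close>; \<open>word_components\<close> is independent of
  representatives; and \<open>free_group_top\<close> is a topology on the carrier of the free group.\<close>

lemma loop_homotopic_iff:
  "loop_homotopic Z z p q \<longleftrightarrow>
     (\<exists>h. continuous_map (prod_topology (top_of_set {0..1::real}) (top_of_set {0..1})) Z h \<and>
        (\<forall>s\<in>{0..1}. h (0, s) = p s) \<and> (\<forall>s\<in>{0..1}. h (1, s) = q s) \<and>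
        (\<forall>t\<in>{0..1}. h (t, 0) = z \<and> h (t, 1) = z))"
proof -
  let ?I = "top_of_set {0..1::real}"
  have "loop_homotopic Z z p q \<longleftrightarrow>
     (\<exists>h. continuous_map (prod_topology ?I ?I) Z h \<and>
        (\<forall>s\<in>topspace ?I. h (0, s) = p s) \<and> (\<forall>s\<in>topspace ?I. h (1, s) = q s) \<and>
        (\<forall>t\<in>{0..1}. h (t, 0) = z \<and> h (t, 1) = z))"
    unfolding loop_homotopic_def by (rule homotopic_with) simp
  then show ?thesis
    unfolding topspace_euclidean_subtopology .
qed

lemma loop_homotopic_refl:
  "p \<in> topspace (loop_space Z z) \<Longrightarrow> loop_homotopic Z z p p"
  by (auto simp: loop_homotopic_def topspace_loop_space pathin_def)

lemma loop_homotopic_sym: "loop_homotopic Z z p q \<Longrightarrow> loop_homotopic Z z q p"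
  unfolding loop_homotopic_def by (rule homotopic_with_symD)

lemma loop_homotopic_trans:
  "loop_homotopic Z z p q \<Longrightarrow> loop_homotopic Z z q r \<Longrightarrow> loop_homotopic Z z p r"
  unfolding loop_homotopic_def by (rule homotopic_with_trans)

lemma loop_class_eq_iff:
  assumes "p \<in> topspace (loop_space Z z)" "q \<in> topspace (loop_space Z z)"
  shows "loop_class Z z p = loop_class Z z q \<longleftrightarrow> loop_homotopic Z z p q"
proof
  assume "loop_class Z z p = loop_class Z z q"
  then have "q \<in> loop_class Z z p"
    using assms(2) by (simp add: loop_class_def loop_homotopic_refl)
  then show "loop_homotopic Z z p q" by (simp add: loop_class_def)
next
  assume pq: "loop_homotopic Z z p q"
  then have "loop_homotopic Z z p r \<longleftrightarrow> loop_homotopic Z z q r" for r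
    using loop_homotopic_sym[OF pq] loop_homotopic_trans[of Z z _ _ r] by blast
  then show "loop_class Z z p = loop_class Z z q" by (simp add: loop_class_def)
qed

lemma loop_class_self: "p \<in> topspace (loop_space Z z) \<Longrightarrow> p \<in> loop_class Z z p"
  by (simp add: loop_class_def loop_homotopic_refl)

lemma loop_space_continuous_map:
  assumes "p \<in> topspace (loop_space Z z)" "continuous_map X (top_of_set {0..1}) f"
  shows "continuous_map X Z (\<lambda>x. p (f x))"
  using assms continuous_map_compose[of X "top_of_set {0..1}" f Z p]
  by (auto simp: topspace_loop_space pathin_def o_def)

lemma path_component_loop_space_iff:
  assumes p: "p \<in> topspace (loop_space Z z)" and q: "q \<in> topspace (loop_space Z z)"
  shows "path_component_of (loop_space Z z) p q \<longleftrightarrow> loop_homotopic Z z p q"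
proof
  let ?I = "top_of_set {0..1::real}"
  assume "loop_homotopic Z z p q"
  then obtain h where h: "continuous_map (prod_topology ?I ?I) Z h"
    and h0: "\<And>s. s \<in> {0..1} \<Longrightarrow> h (0, s) = p s" and h1: "\<And>s. s \<in> {0..1} \<Longrightarrow> h (1, s) = q s"
    and hz: "\<And>t. t \<in> {0..1} \<Longrightarrow> h (t, 0) = z \<and> h (t, 1) = z"
    unfolding loop_homotopic_iff by blast
  define g where "g t = (\<lambda>s\<in>{0..1}. h (t, s))" for t
  have gt: "g t \<in> extensional {0..1}" "continuous_map ?I Z (g t)" "g t 0 = z" "g t 1 = z"
    if "t \<in> {0..1}" for t
  proof -
    have "continuous_map ?I Z (h \<circ> Pair t)"
      using continuous_map_o_Pair[OF h, of t] that by simp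
    then show "continuous_map ?I Z (g t)"
      by (rule continuous_map_eq) (simp add: g_def)
  qed (use that hz in \<open>auto simp: g_def\<close>)
  have "continuous_map ?I (compact_open_topology ?I Z) g"
    unfolding compact_open_topology_def
  proof (rule continuous_on_generated_topo)
    fix W assume "W \<in> {{f \<in> extensional (topspace ?I). continuous_map ?I Z f \<and> f ` K \<subseteq> U} | K U.
          compactin ?I K \<and> openin Z U}"
    then obtain K U where W: "W = {f \<in> extensional (topspace ?I). continuous_map ?I Z f \<and> f ` K \<subseteq> U}"
      and K: "compactin ?I K" and U: "openin Z U" by blast
    have K1: "K \<subseteq> {0..1}" using compactin_subset_topspace[OF K] by simp
    let ?O = "{x \<in> topspace (prod_topology ?I ?I). h x \<in> U}"
    have O: "openin (prod_topology ?I ?I) ?O"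
      by (rule openin_continuous_map_preimage[OF h U])
    have eq: "g -` W \<inter> topspace ?I = {t \<in> {0..1}. \<forall>s\<in>K. h (t, s) \<in> U}"
      using gt K1 by (auto simp: W g_def image_subset_iff)
    show "openin ?I (g -` W \<inter> topspace ?I)"
    proof (subst openin_subopen, intro ballI)
      fix t assume "t \<in> g -` W \<inter> topspace ?I"
      then have t: "t \<in> {0..1}" "\<forall>s\<in>K. h (t, s) \<in> U" unfolding eq by auto
      then have "{t} \<times> K \<subseteq> ?O" using K1 by auto
      then obtain A B where AB: "openin ?I A" "t \<in> A" "K \<subseteq> B" "A \<times> B \<subseteq> ?O"
        using tube_lemma_right[OF O K, of t] t by auto
      have "A \<subseteq> {t \<in> {0..1}. \<forall>s\<in>K. h (t, s) \<in> U}"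
        using AB openin_subset[OF AB(1)] by auto
      then show "\<exists>T. openin ?I T \<and> t \<in> T \<and> T \<subseteq> g -` W \<inter> topspace ?I"
        unfolding eq using AB by blast
    qed
  next
    have "g ` topspace ?I \<subseteq> topspace (compact_open_topology ?I Z)"
      using gt by auto
    then show "g ` topspace ?I \<subseteq> \<Union> {{f \<in> extensional (topspace ?I). continuous_map ?I Z f \<and> f ` K \<subseteq> U} | K U.
          compactin ?I K \<and> openin Z U}"
      unfolding compact_open_topology_def topology_generated_by_topspace .
  qed
  then have "pathin (loop_space Z z) g"
    using gt by (auto simp: loop_space_def pathin_def continuous_map_in_subtopology)
  moreover have "g 0 = p" "g 1 = q"
    using p q h0 h1 by (auto simp: g_def fun_eq_iff topspace_loop_space extensional_def)
  ultimately show "path_component_of (loop_space Z z) p q"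
    by (auto simp: path_component_of_def)
next
  let ?I = "top_of_set {0..1::real}"
  assume "path_component_of (loop_space Z z) p q"
  then obtain g where g: "pathin (loop_space Z z) g" and g0: "g 0 = p" "g 1 = q"
    by (auto simp: path_component_of_def)
  have gc: "continuous_map ?I (compact_open_topology ?I Z) g"
    and gz: "\<And>t. t \<in> {0..1} \<Longrightarrow> g t 0 = z \<and> g t 1 = z"
    using g by (auto simp: pathin_def loop_space_def continuous_map_in_subtopology)
  have gI: "continuous_map ?I Z (g t)" "g t \<in> extensional {0..1}" if "t \<in> {0..1}" for t
    using continuous_map_funspace[OF gc] that by auto
  have "continuous_map (prod_topology ?I ?I) Z (\<lambda>(t, s). g t s)"
    unfolding continuous_map_def
  proof (intro conjI allI impI)
    show "(\<lambda>(t, s). g t s) \<in> topspace (prod_topology ?I ?I) \<rightarrow> topspace Z"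
      using gI(1) by (fastforce simp: continuous_map_def)
  next
    fix U assume U: "openin Z U"
    let ?P = "{x \<in> topspace (prod_topology ?I ?I). (case x of (t, s) \<Rightarrow> g t s) \<in> U}"
    show "openin (prod_topology ?I ?I) ?P"
    proof (subst openin_subopen, intro ballI)
      fix x assume "x \<in> ?P"
      then obtain t s where x: "x = (t, s)" "t \<in> {0..1}" "s \<in> {0..1}" "g t s \<in> U" by auto
      have "openin ?I {r \<in> topspace ?I. g t r \<in> U}"
        by (rule openin_continuous_map_preimage[OF gI(1) U]) (use x in auto)
      then obtain e where e: "e > 0" "\<And>r. r \<in> {0..1} \<Longrightarrow> dist r s < e \<Longrightarrow> g t r \<in> U"
        using x by (force simp: openin_euclidean_subtopology_iff)
      define K where "K = {0..1} \<inter> cball s (e/2)"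
      have K: "compactin ?I K"
        by (simp add: K_def compactin_subtopology compact_Int)
      have KU: "g t ` K \<subseteq> U"
        using e by (auto simp: K_def dist_commute)
      let ?W = "{f \<in> extensional (topspace ?I). continuous_map ?I Z f \<and> f ` K \<subseteq> U}"
      have "openin (compact_open_topology ?I Z) ?W"
        unfolding compact_open_topology_def
        by (rule topology_generated_by_Basis) (use K U in blast)
      then have A: "openin ?I {r \<in> topspace ?I. g r \<in> ?W}"
        by (rule openin_continuous_map_preimage[OF gc])
      have B: "openin ?I ({0..1} \<inter> ball s (e/2))"
        by (simp add: openin_open_Int)
      let ?T = "{r \<in> topspace ?I. g r \<in> ?W} \<times> ({0..1} \<inter> ball s (e/2))"
      have "openin (prod_topology ?I ?I) ?T"
        using A B openin_prod_Times_iff by blast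
      moreover have "x \<in> ?T" using x e gI[of t] KU by auto
      moreover have "?T \<subseteq> ?P" by (auto simp: K_def image_subset_iff)
      ultimately show "\<exists>T. openin (prod_topology ?I ?I) T \<and> x \<in> T \<and> T \<subseteq> ?P" by blast
    qed
  qed
  then show "loop_homotopic Z z p q"
    unfolding loop_homotopic_iff using g0 gz by (intro exI[of _ "\<lambda>(t, s). g t s"]) auto
qed


lemma loop_class_eq_path_component:
  assumes "p \<in> topspace (loop_space Z z)"
  shows "loop_class Z z p = path_component_of_set (loop_space Z z) p"
proof -
  have "q \<in> topspace (loop_space Z z)" if "path_component_of (loop_space Z z) p q" for q
    using path_component_in_topspace[OF that] by blast
  then show ?thesis
    using path_component_loop_space_iff[OF assms] by (auto simp: loop_class_def)
qed

lemma pi1_top_eq_pi0_top: "pi1_top Z z = pi0_top (loop_space Z z)"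
  unfolding pi1_top_def pi0_top_def
  by (rule quotient_topology_cong) (rule loop_class_eq_path_component)

lemma loop_concat_in:
  assumes p: "p \<in> topspace (loop_space Z z)" and q: "q \<in> topspace (loop_space Z z)"
  shows "loop_concat p q \<in> topspace (loop_space Z z)"
proof -
  let ?I = "top_of_set {0..1::real}"
  let ?f = "\<lambda>t::real. if t \<le> 1/2 then p (2 * t) else q (2 * t - 1)"
  have "continuous_map ?I Z ?f"
  proof (rule continuous_map_cases_le)
    show "continuous_map (subtopology ?I {x. x \<in> topspace ?I \<and> x \<le> 1/2}) Z (\<lambda>t. p (2 * t))"
      by (rule loop_space_continuous_map[OF p])
        (auto simp: continuous_map_in_subtopology subtopology_subtopology intro!: continuous_intros)
    show "continuous_map (subtopology ?I {x. x \<in> topspace ?I \<and> 1/2 \<le> x}) Z (\<lambda>t. q (2 * t - 1))"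
      by (rule loop_space_continuous_map[OF q])
        (auto simp: continuous_map_in_subtopology subtopology_subtopology intro!: continuous_intros)
    show "p (2 * x) = q (2 * x - 1)" if "x = 1/2" for x
      using p q by (simp add: that topspace_loop_space)
  qed (auto intro!: continuous_intros)
  then have "continuous_map ?I Z (loop_concat p q)"
    by (rule continuous_map_eq) (simp add: loop_concat_def)
  then show ?thesis
    using p q by (auto simp: topspace_loop_space pathin_def loop_concat_def)
qed

lemma loop_concat_homotopic:
  assumes pp: "loop_homotopic Z z p p'" and qq: "loop_homotopic Z z q q'"
  shows "loop_homotopic Z z (loop_concat p q) (loop_concat p' q')"
proof -
  let ?I = "top_of_set {0..1::real}"
  obtain h where h: "continuous_map (prod_topology ?I ?I) Z h"
     "\<And>s. s \<in> {0..1} \<Longrightarrow> h (0, s) = p s" "\<And>s. s \<in> {0..1} \<Longrightarrow> h (1, s) = p' s"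
     "\<And>t. t \<in> {0..1} \<Longrightarrow> h (t, 0) = z" "\<And>t. t \<in> {0..1} \<Longrightarrow> h (t, 1) = z"
    using pp unfolding loop_homotopic_iff by blast
  obtain k where k: "continuous_map (prod_topology ?I ?I) Z k"
     "\<And>s. s \<in> {0..1} \<Longrightarrow> k (0, s) = q s" "\<And>s. s \<in> {0..1} \<Longrightarrow> k (1, s) = q' s"
     "\<And>t. t \<in> {0..1} \<Longrightarrow> k (t, 0) = z" "\<And>t. t \<in> {0..1} \<Longrightarrow> k (t, 1) = z"
    using qq unfolding loop_homotopic_iff by blast
  let ?H = "\<lambda>x::real\<times>real. if snd x \<le> 1/2 then h (fst x, 2 * snd x) else k (fst x, 2 * snd x - 1)"
  have "continuous_map (prod_topology ?I ?I) Z ?H"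
  proof (rule continuous_map_cases_le)
    show "continuous_map (subtopology (prod_topology ?I ?I) {x. x \<in> topspace (prod_topology ?I ?I) \<and> snd x \<le> 1/2}) Z (\<lambda>x. h (fst x, 2 * snd x))"
      by (rule continuous_map_compose[OF _ h(1), unfolded o_def])
        (auto simp: continuous_map_in_subtopology subtopology_subtopology intro!: continuous_intros)
    show "continuous_map (subtopology (prod_topology ?I ?I) {x. x \<in> topspace (prod_topology ?I ?I) \<and> 1/2 \<le> snd x}) Z (\<lambda>x. k (fst x, 2 * snd x - 1))"
      by (rule continuous_map_compose[OF _ k(1), unfolded o_def])
        (auto simp: continuous_map_in_subtopology subtopology_subtopology intro!: continuous_intros)
    show "h (fst x, 2 * snd x) = k (fst x, 2 * snd x - 1)"
      if "x \<in> topspace (prod_topology ?I ?I)" "snd x = 1/2" for x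
      using that(1) h(5)[of "fst x"] k(4)[of "fst x"] by (auto simp: that(2))
  qed (auto intro!: continuous_intros)
  then show ?thesis
    unfolding loop_homotopic_iff
    using h(2-) k(2-) by (intro exI[of _ ?H] conjI) (auto simp: loop_concat_def)
qed

lemma loop_reparametrize:
  assumes p: "p \<in> topspace (loop_space Z z)"
    and f: "continuous_on {0..1} f" "f \<in> {0..1} \<rightarrow> {0..1}"
    and g: "continuous_on {0..1} g" "g \<in> {0..1} \<rightarrow> {0..1}"
    and fg: "f 0 = g 0" "f 1 = g 1" "p (f 0) = z" "p (f 1) = z"
  shows "loop_homotopic Z z (\<lambda>t\<in>{0..1}. p (f t)) (\<lambda>t\<in>{0..1::real}. p (g t))"
proof -
  let ?I = "top_of_set {0..1::real}"
  let ?r = "\<lambda>x. (1 - fst x) * f (snd x) + fst x * g (snd x)"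
  have "?r x \<in> {0..1}" if "x \<in> {0..1} \<times> {0..1}" for x
  proof -
    have "(1 - fst x) *\<^sub>R f (snd x) + fst x *\<^sub>R g (snd x) \<in> {0..1}"
      by (rule convexD[OF convex_real_interval(5)]) (use that f g in auto)
    then show ?thesis by simp
  qed
  moreover have "continuous_on ({0..1} \<times> {0..1}) ?r"
    by (intro continuous_intros continuous_on_compose2[OF f(1)] continuous_on_compose2[OF g(1)]) auto
  ultimately have "continuous_map (prod_topology ?I ?I) ?I ?r"
    by (auto simp: continuous_map_in_subtopology)
  then have "continuous_map (prod_topology ?I ?I) Z (\<lambda>x. p (?r x))"
    by (rule loop_space_continuous_map[OF p])
  then show ?thesis
    unfolding loop_homotopic_iff
    using fg by (intro exI[of _ "\<lambda>x. p (?r x)"] conjI) (auto simp: algebra_simps)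
qed

lemma cons_reduce_reduced: "reduced_word w \<Longrightarrow> reduced_word (cons_reduce a w)"
  by (cases w rule: reduced_word.cases) (auto split: if_splits)

lemma foldr_cons_reduce_reduced: "reduced_word w \<Longrightarrow> reduced_word (foldr cons_reduce u w)"
  by (induction u) (auto intro: cons_reduce_reduced)

lemma reduce_word_reduced: "reduced_word (reduce_word w)"
  by (simp add: reduce_word_def foldr_cons_reduce_reduced)

lemma cons_reduce_eq_Cons: "reduced_word (a # w) \<Longrightarrow> cons_reduce a w = a # w"
  by (cases w) auto

lemma reduced_word_ConsD: "reduced_word (a # w) \<Longrightarrow> reduced_word w"
  by (cases w) auto

lemma reduce_word_eq: "reduced_word w \<Longrightarrow> reduce_word w = w"
proof (induction w)
  case (Cons a w)
  then show ?case
    using reduced_word_ConsD[OF Cons.prems] cons_reduce_eq_Cons[OF Cons.prems]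
    by (simp add: reduce_word_def)
qed (simp add: reduce_word_def)

lemma cons_reduce_cancel:
  "reduced_word w \<Longrightarrow> snd a = snd b \<Longrightarrow> fst a \<noteq> fst b \<Longrightarrow> cons_reduce a (cons_reduce b w) = w"
proof (cases w)
  case (Cons c v)
  assume "reduced_word w" "snd a = snd b" "fst a \<noteq> fst b"
  then show ?thesis
    using Cons by (cases "snd b = snd c \<and> fst b \<noteq> fst c"; cases v) (auto simp: prod_eq_iff)
qed auto

lemma foldr_cons_reduce_cons_reduce:
  assumes "reduced_word w"
  shows "foldr cons_reduce (cons_reduce a u) w = cons_reduce a (foldr cons_reduce u w)"
proof (cases u)
  case (Cons b v)
  then show ?thesis
    using cons_reduce_cancel[of "foldr cons_reduce v w" a b] foldr_cons_reduce_reduced[OF assms]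
    by auto
qed auto

lemma foldr_cons_reduce_reduce_word:
  assumes "reduced_word w"
  shows "foldr cons_reduce (reduce_word u) w = foldr cons_reduce u w"
  unfolding reduce_word_def
  by (induction u) (auto simp: foldr_cons_reduce_cons_reduce[OF assms])

lemma reduce_word_append: "reduce_word (u @ v) = foldr cons_reduce u (reduce_word v)"
  by (simp add: reduce_word_def)

lemma reduce_word_append_left: "reduce_word (reduce_word u @ v) = reduce_word (u @ v)"
  by (simp add: reduce_word_append foldr_cons_reduce_reduce_word reduce_word_reduced)

lemma reduce_word_append_right: "reduce_word (u @ reduce_word v) = reduce_word (u @ v)"
  by (simp add: reduce_word_append reduce_word_eq reduce_word_reduced)

lemma reduce_word_lists: "w \<in> lists A \<Longrightarrow> reduce_word w \<in> lists A"
proof -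
  have *: "set (cons_reduce a u) \<subseteq> insert a (set u)" for a :: "bool \<times> 'a" and u
    by (cases u) auto
  have "set (reduce_word w) \<subseteq> set w"
  proof (induction w)
    case (Cons a w)
    then show ?case
      using *[of a "reduce_word w"] by (auto simp: reduce_word_def simp del: cons_reduce.simps)
  qed (simp add: reduce_word_def)
  then show "w \<in> lists A \<Longrightarrow> reduce_word w \<in> lists A" by auto
qed

lemma reduce_word_inverse:
  "reduce_word (map (\<lambda>(e, x). (\<not> e, x)) (rev w) @ w) = []"
proof (induction w)
  case (Cons a w)
  let ?i = "map (\<lambda>(e, x). (\<not> e, x)) (rev w)"
  have "reduce_word (map (\<lambda>(e, x). (\<not> e, x)) (rev (a # w)) @ a # w) =
        foldr cons_reduce ?i (cons_reduce (\<not> fst a, snd a) (cons_reduce a (reduce_word w)))"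
    by (simp add: reduce_word_def case_prod_unfold)
  also have "\<dots> = reduce_word (?i @ w)"
    by (simp add: cons_reduce_cancel reduce_word_reduced reduce_word_append)
  finally show ?case using Cons by simp
qed (simp add: reduce_word_def)

lemma group_free_group: "group (free_group S)"
proof (rule groupI)
  fix w assume w: "w \<in> carrier (free_group S)"
  let ?i = "map (\<lambda>(e, x). (\<not> e, x)) (rev w)"
  have "reduce_word ?i \<in> carrier (free_group S)"
    using w by (auto simp: free_group_def reduce_word_reduced intro!: reduce_word_lists)
  moreover have "reduce_word ?i \<otimes>\<^bsub>free_group S\<^esub> w = \<one>\<^bsub>free_group S\<^esub>"
    by (simp add: free_group_def reduce_word_append_left reduce_word_inverse)
  ultimately show "\<exists>v\<in>carrier (free_group S). v \<otimes>\<^bsub>free_group S\<^esub> w = \<one>\<^bsub>free_group S\<^esub>" by blast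
qed (auto simp: free_group_def reduce_word_reduced reduce_word_eq reduce_word_append_left
      reduce_word_append_right intro!: reduce_word_lists)


lemma const_loop_in: "z \<in> topspace Z \<Longrightarrow> (\<lambda>t\<in>{0..1}. z) \<in> topspace (loop_space Z z)"
  by (auto simp: topspace_loop_space pathin_def
      intro!: continuous_map_eq[of "top_of_set {0..1}" Z "\<lambda>_. z"])

lemma pi1_mult_class:
  assumes p: "p \<in> topspace (loop_space Z z)" and q: "q \<in> topspace (loop_space Z z)"
  shows "loop_class Z z p \<otimes>\<^bsub>pi1 Z z\<^esub> loop_class Z z q = loop_class Z z (loop_concat p q)"
proof -
  have "loop_class Z z (loop_concat p' q') = loop_class Z z (loop_concat p q)"
    if "p' \<in> loop_class Z z p" "q' \<in> loop_class Z z q" for p' q'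
  proof -
    have "loop_homotopic Z z (loop_concat p q) (loop_concat p' q')"
      using that by (auto simp: loop_class_def intro: loop_concat_homotopic)
    then show ?thesis
      using that p q by (auto simp: loop_class_eq_iff loop_class_def[of Z z p] loop_class_def[of Z z q]
          loop_concat_in loop_homotopic_sym)
  qed
  then have "(\<Union>p'\<in>loop_class Z z p. \<Union>q'\<in>loop_class Z z q. loop_class Z z (loop_concat p' q'))
      = (\<Union>p'\<in>loop_class Z z p. \<Union>q'\<in>loop_class Z z q. loop_class Z z (loop_concat p q))"
    by (intro SUP_cong refl) blast
  then show ?thesis
    using loop_class_self[OF p] loop_class_self[OF q] by (auto simp: pi1_def)
qed

lemma loop_reparametrize_class:
  assumes p: "p \<in> topspace (loop_space Z z)"
    and f: "continuous_on {0..1} f" "f \<in> {0..1} \<rightarrow> {0..1::real}"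
    and g: "continuous_on {0..1} g" "g \<in> {0..1} \<rightarrow> {0..1}"
    and fg: "f 0 = g 0" "f 1 = g 1" "p (f 0) = z" "p (f 1) = z"
    and uv: "\<And>t. t \<in> {0..1} \<Longrightarrow> u t = p (f t)" "\<And>t. t \<in> {0..1} \<Longrightarrow> v t = p (g t)"
    and ext: "u \<in> topspace (loop_space Z z)" "v \<in> topspace (loop_space Z z)"
  shows "loop_class Z z u = loop_class Z z v"
proof -
  have "u = (\<lambda>t\<in>{0..1}. p (f t))" "v = (\<lambda>t\<in>{0..1}. p (g t))"
    using uv ext by (auto simp: topspace_loop_space extensional_def fun_eq_iff)
  then show ?thesis
    using loop_reparametrize[OF p f g fg] ext by (simp add: loop_class_eq_iff)
qed

lemma loop_reverse_in:
  assumes p: "p \<in> topspace (loop_space Z z)"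
  shows "(\<lambda>t\<in>{0..1}. p (1 - t)) \<in> topspace (loop_space Z z)"
proof -
  have "continuous_map (top_of_set {0..1}) Z (\<lambda>t. p (1 - t))"
    by (rule loop_space_continuous_map[OF p])
      (auto simp: continuous_map_in_subtopology intro!: continuous_intros)
  then have "continuous_map (top_of_set {0..1}) Z (\<lambda>t\<in>{0..1}. p (1 - t))"
    by (rule continuous_map_eq) simp
  then show ?thesis using p by (auto simp: topspace_loop_space pathin_def)
qed

lemma group_pi1:
  assumes z: "z \<in> topspace Z"
  shows "group (pi1 Z z)"
proof (rule groupI)
  note c = const_loop_in[OF z]
  have car: "carrier (pi1 Z z) = loop_class Z z ` topspace (loop_space Z z)"
    and one: "\<one>\<^bsub>pi1 Z z\<^esub> = loop_class Z z (\<lambda>t\<in>{0..1}. z)"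
    by (simp_all add: pi1_def)
  show "\<one>\<^bsub>pi1 Z z\<^esub> \<in> carrier (pi1 Z z)" using c car one by auto
  fix A assume "A \<in> carrier (pi1 Z z)"
  then obtain p where p: "p \<in> topspace (loop_space Z z)" and A: "A = loop_class Z z p"
    using car by auto
  have p01: "p 0 = z" "p 1 = z" using p by (auto simp: topspace_loop_space)
  have "loop_class Z z (loop_concat (\<lambda>t\<in>{0..1}. z) p) = loop_class Z z p"
  proof (rule loop_reparametrize_class[OF p, of "\<lambda>t. max 0 (2 * t - 1)" "\<lambda>t. t"])
    show "loop_concat (\<lambda>t\<in>{0..1}. z) p t = p (max 0 (2 * t - 1))" if "t \<in> {0..1}" for t
    proof (cases t "1/2 :: real" rule: linorder_cases)
      case equal
      show ?thesis unfolding equal using p01 by (simp add: loop_concat_def)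
    qed (use that p01 in \<open>auto simp: loop_concat_def max_def\<close>)
    show "continuous_on {0..1} (\<lambda>t::real. max 0 (2 * t - 1))" by (intro continuous_intros)
  qed (use p01 p loop_concat_in[OF c p] in auto)
  then show "\<one>\<^bsub>pi1 Z z\<^esub> \<otimes>\<^bsub>pi1 Z z\<^esub> A = A"
    by (simp add: one A pi1_mult_class[OF c p])
  let ?r = "\<lambda>t\<in>{0..1}. p (1 - t)"
  note r = loop_reverse_in[OF p]
  have "loop_class Z z (loop_concat ?r p) = loop_class Z z (\<lambda>t\<in>{0..1}. z)"
  proof (rule loop_reparametrize_class[OF p, of "\<lambda>t. \<bar>1 - 2 * t\<bar>" "\<lambda>t. 1"])
    show "loop_concat ?r p t = p \<bar>1 - 2 * t\<bar>" if "t \<in> {0..1}" for t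
      using that by (auto simp: loop_concat_def abs_if)
    show "continuous_on {0..1} (\<lambda>t::real. \<bar>1 - 2 * t\<bar>)" by (intro continuous_intros)
  qed (use p01 c loop_concat_in[OF r p] in auto)
  then show "\<exists>B\<in>carrier (pi1 Z z). B \<otimes>\<^bsub>pi1 Z z\<^esub> A = \<one>\<^bsub>pi1 Z z\<^esub>"
    using r by (intro bexI[of _ "loop_class Z z ?r"]) (auto simp: one A car pi1_mult_class[OF r p])
  fix B assume "B \<in> carrier (pi1 Z z)"
  then obtain q where q: "q \<in> topspace (loop_space Z z)" and B: "B = loop_class Z z q"
    using car by auto
  show "A \<otimes>\<^bsub>pi1 Z z\<^esub> B \<in> carrier (pi1 Z z)"
    using loop_concat_in[OF p q] by (simp add: A B pi1_mult_class[OF p q] car)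
  fix C assume "C \<in> carrier (pi1 Z z)"
  then obtain s where s: "s \<in> topspace (loop_space Z z)" and C: "C = loop_class Z z s"
    using car by auto
  note pq = loop_concat_in[OF p q] and qs = loop_concat_in[OF q s]
  note p_qs = loop_concat_in[OF p qs] and pq_s = loop_concat_in[OF pq s]
  have cf: "continuous_on {0..1} (\<lambda>t::real. min (min (2 * t) (t + 1/4)) (t / 2 + 1/2))"
    by (intro continuous_intros) auto
  have "loop_class Z z (loop_concat (loop_concat p q) s) = loop_class Z z (loop_concat p (loop_concat q s))"
  proof (rule loop_reparametrize_class[OF p_qs cf _ continuous_on_id])
    have "q 0 = z" "q 1 = z" "s 0 = z" using q s by (auto simp: topspace_loop_space)
    show "loop_concat (loop_concat p q) s t =
        loop_concat p (loop_concat q s) (min (min (2 * t) (t + 1/4)) (t / 2 + 1/2))"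
      if "t \<in> {0..1}" for t
    proof -
      consider "t \<le> 1/4" | "1/4 < t" "t \<le> 1/2" | "1/2 < t" by linarith
      then show ?thesis
      proof cases
        case 1
        then have "min (min (2 * t) (t + 1/4)) (t / 2 + 1/2) = 2 * t" by (simp add: min_def)
        then show ?thesis using 1 that by (simp add: loop_concat_def)
      next
        case 2
        then have "min (min (2 * t) (t + 1/4)) (t / 2 + 1/2) = t + 1/4" by (simp add: min_def)
        then show ?thesis using 2 that by (simp add: loop_concat_def algebra_simps)
      next
        case 3
        then have "min (min (2 * t) (t + 1/4)) (t / 2 + 1/2) = t / 2 + 1/2" by (simp add: min_def)
        then show ?thesis using 3 that by (simp add: loop_concat_def algebra_simps)
      qed
    qed
  qed (use p_qs pq_s in \<open>auto simp: min_def topspace_loop_space\<close>)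
  then show "A \<otimes>\<^bsub>pi1 Z z\<^esub> B \<otimes>\<^bsub>pi1 Z z\<^esub> C = A \<otimes>\<^bsub>pi1 Z z\<^esub> (B \<otimes>\<^bsub>pi1 Z z\<^esub> C)"
    using p q s pq qs by (simp add: A B C pi1_mult_class)
qed

lemma susp_base_in: "susp_base X \<in> topspace (suspension_plus X)"
proof -
  have "susp_proj X (None, 0) = susp_base X" by (simp add: susp_proj_def susp_collapsed_def)
  then show ?thesis by (force simp: suspension_plus_def image_iff)
qed

lemma susp_strip_continuous:
  "continuous_map (prod_topology X (top_of_set {0..1})) (suspension_plus X)
     (\<lambda>(x, t). susp_proj X (Some x, t))"
proof -
  have "continuous_map X (plus_topology X) Some"
    unfolding continuous_map_def
  proof (intro conjI allI impI)
    fix U assume "openin (plus_topology X) U"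
    then have U: "openin X {x. Some x \<in> U}" by (simp add: openin_plus_topology)
    then have "{x \<in> topspace X. Some x \<in> U} = {x. Some x \<in> U}" using openin_subset by blast
    then show "openin X {x \<in> topspace X. Some x \<in> U}" using U by simp
  qed auto
  from continuous_map_compose[OF continuous_map_fst this]
  have "continuous_map (prod_topology X (top_of_set {0..1})) (plus_topology X) (\<lambda>p. Some (fst p))"
    by (simp add: o_def)
  from continuous_map_pairedI[OF this continuous_map_snd]
  have "continuous_map (prod_topology X (top_of_set {0..1}))
      (prod_topology (plus_topology X) (top_of_set {0..1::real})) (\<lambda>p. (Some (fst p), snd p))" .
  from continuous_map_compose[OF this quotient_imp_continuous_map[OF quotient_map_quotient_topology[of _ "susp_proj X"]]]
  show ?thesis by (simp add: suspension_plus_def o_def case_prod_unfold)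
qed

lemma susp_loop_in:
  assumes "x \<in> topspace X"
  shows "susp_loop X x \<in> topspace (loop_space (suspension_plus X) (susp_base X))"
proof -
  have "continuous_map (top_of_set {0..1}) (suspension_plus X) (\<lambda>t. susp_proj X (Some x, t))"
    using continuous_map_o_Pair[OF susp_strip_continuous assms] by (simp add: o_def)
  then have "continuous_map (top_of_set {0..1}) (suspension_plus X) (susp_loop X x)"
    by (rule continuous_map_eq) (simp add: susp_loop_def)
  then show ?thesis
    using assms by (auto simp: topspace_loop_space pathin_def susp_loop_def susp_proj_def susp_collapsed_def)
qed

lemma susp_gen_path_component:
  assumes x: "x \<in> topspace X"
  shows "susp_gen X (path_component_of_set X x) =
    loop_class (suspension_plus X) (susp_base X) (susp_loop X x)"
proof -
  let ?I = "top_of_set {0..1::real}"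
  have "loop_class (suspension_plus X) (susp_base X) (susp_loop X y) =
        loop_class (suspension_plus X) (susp_base X) (susp_loop X x)"
    if xy: "path_component_of X x y" for y
  proof -
    have y: "y \<in> topspace X" using xy path_component_in_topspace[of X x y] by blast
    obtain g where g: "pathin X g" "g 0 = x" "g 1 = y"
      using xy by (auto simp: path_component_of_def)
    have gX: "g t \<in> topspace X" if "t \<in> {0..1}" for t
      using g that by (auto simp: pathin_def continuous_map_def Pi_iff)
    have "continuous_map (prod_topology ?I ?I) (prod_topology X ?I) (\<lambda>(t, s). (g t, s))"
    proof -
      have "continuous_map (prod_topology ?I ?I) X (g \<circ> fst)"
        using g(1) by (intro continuous_map_compose[OF continuous_map_fst]) (simp add: pathin_def)
      from continuous_map_pairedI[OF this continuous_map_snd]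
      show ?thesis by (simp only: o_def case_prod_unfold)
    qed
    from continuous_map_compose[OF this susp_strip_continuous]
    have "continuous_map (prod_topology ?I ?I) (suspension_plus X) (\<lambda>(t, s). susp_proj X (Some (g t), s))"
      by (simp add: o_def case_prod_unfold)
    then have "loop_homotopic (suspension_plus X) (susp_base X) (susp_loop X x) (susp_loop X y)"
      unfolding loop_homotopic_iff
      using g gX by (intro exI[of _ "\<lambda>(t, s). susp_proj X (Some (g t), s)"])
        (auto simp: susp_loop_def susp_proj_def susp_collapsed_def)
    then show ?thesis
      using x y by (simp add: loop_class_eq_iff susp_loop_in loop_homotopic_sym)
  qed
  then have "(\<lambda>y. loop_class (suspension_plus X) (susp_base X) (susp_loop X y)) ` path_component_of_set X x
      \<subseteq> {loop_class (suspension_plus X) (susp_base X) (susp_loop X x)}" by blast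
  moreover have "x \<in> path_component_of_set X x" using x by (simp add: path_component_of_refl)
  ultimately have "(\<lambda>y. loop_class (suspension_plus X) (susp_base X) (susp_loop X y)) ` path_component_of_set X x
      = {loop_class (suspension_plus X) (susp_base X) (susp_loop X x)}" by (auto simp only:)
  then show ?thesis unfolding susp_gen_def by (simp only: Union_insert Union_empty Un_empty_right)
qed

lemma susp_hom_generator:
  assumes x: "x \<in> topspace X"
  shows "susp_hom X [(True, path_component_of_set X x)] =
    loop_class (suspension_plus X) (susp_base X) (susp_loop X x)"
proof -
  interpret G: group "susp_pi1 X" by (rule group_pi1[OF susp_base_in])
  have "loop_class (suspension_plus X) (susp_base X) (susp_loop X x) \<in> carrier (susp_pi1 X)"
    using susp_loop_in[OF x] by (simp add: pi1_def)
  then show ?thesis by (simp add: susp_hom_def susp_gen_path_component[OF x])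
qed

lemma pathin_sum_topology:
  assumes g: "pathin (sum_topology Y I) g"
  obtains i where "i \<in> I" "\<And>t. t \<in> {0..1} \<Longrightarrow> fst (g t) = i" "pathin (Y i) (snd \<circ> g)"
proof -
  have gc: "continuous_map (top_of_set {0..1}) (sum_topology Y I) g" using g by (simp add: pathin_def)
  have gY: "fst (g t) \<in> I \<and> snd (g t) \<in> topspace (Y (fst (g t)))" if "t \<in> {0..1}" for t
    using continuous_map_funspace[OF gc] that by (force simp: Pi_iff)
  have "continuous_map (sum_topology Y I) (discrete_topology I) fst"
  proof -
    have "openin (Y i) {x \<in> topspace (Y i). i \<in> U}" for i U by (cases "i \<in> U") auto
    then show ?thesis by (auto simp: continuous_map_def openin_sum_topology)
  qed
  from connectedin_continuous_map_image[OF this connectedin_path_image[OF g]]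
  have "\<exists>i. fst ` g ` {0..1} \<subseteq> {i}" by (auto simp: connectedin_discrete_topology)
  then obtain i where "fst ` g ` {0..1} \<subseteq> {i}" by blast
  then have i: "fst (g t) = i" if "t \<in> {0..1}" for t using that by blast
  have iI: "i \<in> I" using gY[of 0] i[of 0] by auto
  have "continuous_map (top_of_set {0..1}) (Y i) (snd \<circ> g)"
    unfolding continuous_map_def
  proof (intro conjI allI impI)
    show "snd \<circ> g \<in> topspace (top_of_set {0..1}) \<rightarrow> topspace (Y i)"
      using gY i by auto
    fix U assume "openin (Y i) U"
    then have "openin (sum_topology Y I) (Pair i ` U)"
      using open_map_component_injection[OF iI, of Y] by (auto simp: open_map_def)
    from openin_continuous_map_preimage[OF gc this]
    have "openin (top_of_set {0..1}) {t \<in> topspace (top_of_set {0..1}). g t \<in> Pair i ` U}" .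
    moreover have "g t \<in> Pair i ` U \<longleftrightarrow> (snd \<circ> g) t \<in> U" if "t \<in> {0..1}" for t
      using i[OF that] by (cases "g t") auto
    ultimately show "openin (top_of_set {0..1}) {t \<in> topspace (top_of_set {0..1}). (snd \<circ> g) t \<in> U}"
      by (simp cong: conj_cong)
  qed
  then show thesis using that[OF iI i] by (simp add: pathin_def)
qed

lemma homeomorphic_map_free_monoid_top:
  "homeomorphic_map (sum_topology (\<lambda>n. product_topology (\<lambda>_. letter_space Y) {..<n}) UNIV)
     (free_monoid_top Y) (\<lambda>(n, f). map f [0..<n])"
proof -
  have "inj_on (\<lambda>(n, f). map f [0..<n])
     (Sigma UNIV (\<lambda>n. PiE {..<n} (\<lambda>_. topspace (letter_space Y))))"
  proof (rule inj_onI, clarify)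
    fix n m f g
    assume f: "f \<in> PiE {..<n} (\<lambda>_. topspace (letter_space Y))"
      and g: "g \<in> PiE {..<m} (\<lambda>_. topspace (letter_space Y))"
      and eq: "map f [0..<n] = map g [0..<m]"
    have nm: "n = m" using arg_cong[OF eq, of length] by simp
    have "f = g" by (rule PiE_ext[OF f g[folded nm]]) (use eq nm in auto)
    then show "n = m \<and> f = g" using nm by simp
  qed
  then show ?thesis
    by (simp add: homeomorphic_map_def free_monoid_top_def quotient_map_quotient_topology o_def)
qed

lemma word_components_path_component:
  assumes w: "w \<in> topspace (free_monoid_top X)"
  shows "word_components X (path_component_of_set (free_monoid_top X) w) =
    map (\<lambda>(e, x). (e, path_component_of_set X x)) w"
proof -
  let ?P = "\<lambda>(e, x). (e, path_component_of_set X x)"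
  let ?S = "sum_topology (\<lambda>n. product_topology (\<lambda>_. letter_space X) {..<n}) UNIV"
  have "map ?P v = map ?P w" if vw: "path_component_of (free_monoid_top X) w v" for v
  proof -
    obtain g where g: "pathin (free_monoid_top X) g" "g 0 = w" "g 1 = v"
      using vw by (auto simp: path_component_of_def)
    obtain k where k: "homeomorphic_maps ?S (free_monoid_top X) (\<lambda>(n, f). map f [0..<n]) k"
      using homeomorphic_map_free_monoid_top homeomorphic_map_maps by blast
    have "pathin ?S (k \<circ> g)"
      using pathin_compose[OF g(1), of ?S k] k by (simp add: homeomorphic_maps_def)
    then obtain n where n: "\<And>t. t \<in> {0..1} \<Longrightarrow> fst ((k \<circ> g) t) = n"
      and pn: "pathin (product_topology (\<lambda>_. letter_space X) {..<n}) (snd \<circ> (k \<circ> g))"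
      by (rule pathin_sum_topology) blast
    have kg: "g t = map (snd (k (g t))) [0..<n]" if "t \<in> {0..1}" for t
    proof -
      have "g t \<in> topspace (free_monoid_top X)"
        using g(1) that by (auto simp: pathin_def continuous_map_def Pi_iff)
      then have "(\<lambda>(n, f). map f [0..<n]) (k (g t)) = g t"
        using k by (simp add: homeomorphic_maps_def)
      then show ?thesis using n[OF that] by (simp add: case_prod_unfold)
    qed
    have "?P (snd (k (g 0)) i) = ?P (snd (k (g 1)) i)" if i: "i < n" for i
    proof -
      have "pathin (letter_space X) ((\<lambda>f. f i) \<circ> (snd \<circ> (k \<circ> g)))"
        by (rule pathin_compose[OF pn continuous_map_product_projection]) (use i in simp)
      then obtain e where e: "\<And>t. t \<in> {0..1} \<Longrightarrow> fst (snd (k (g t)) i) = e"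
        and pe: "pathin X (snd \<circ> ((\<lambda>f. f i) \<circ> (snd \<circ> (k \<circ> g))))"
        unfolding letter_space_def by (rule pathin_sum_topology) auto
      have "path_component_of X (snd (snd (k (g 0)) i)) (snd (snd (k (g 1)) i))"
        unfolding path_component_of_def
        by (rule exI[of _ "snd \<circ> ((\<lambda>f. f i) \<circ> (snd \<circ> (k \<circ> g)))"]) (use pe in simp)
      then have "path_component_of_set X (snd (snd (k (g 0)) i)) = path_component_of_set X (snd (snd (k (g 1)) i))"
        by (intro Collect_cong) (metis path_component_of_sym path_component_of_trans)
      then show ?thesis using e[of 0] e[of 1] by (simp add: case_prod_unfold)
    qed
    then have "map ?P (map (snd (k (g 0))) [0..<n]) = map ?P (map (snd (k (g 1))) [0..<n])"
      by (simp del: split_paired_All)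
    moreover have "map (snd (k (g 0))) [0..<n] = w" "map (snd (k (g 1))) [0..<n] = v"
      using kg[of 0] kg[of 1] g(2,3) by simp_all
    ultimately show ?thesis by (simp only:)
  qed
  then have "map ?P ` path_component_of_set (free_monoid_top X) w \<subseteq> {map ?P w}"
    by blast
  moreover have "w \<in> path_component_of_set (free_monoid_top X) w"
    using w by (simp add: path_component_of_refl)
  ultimately have "map ?P ` path_component_of_set (free_monoid_top X) w = {map ?P w}"
    by (auto simp only:)
  then show ?thesis by (simp add: word_components_def)
qed

lemma topspace_free_monoid_top: "topspace (free_monoid_top Y) = lists (UNIV \<times> topspace Y)"
proof -
  have L: "topspace (letter_space Y) = UNIV \<times> topspace Y" by (auto simp: letter_space_def)
  have "w \<in> topspace (free_monoid_top Y)" if "w \<in> lists (UNIV \<times> topspace Y)" for w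
  proof -
    have "w = map (restrict ((!) w) {..<length w}) [0..<length w]"
      by (rule nth_equalityI) auto
    moreover have "restrict ((!) w) {..<length w} \<in> PiE {..<length w} (\<lambda>_. UNIV \<times> topspace Y)"
      using that by (auto simp: in_lists_conv_set)
    ultimately have "w \<in> (\<lambda>(n, f). map f [0..<n]) ` Sigma UNIV (\<lambda>n. PiE {..<n} (\<lambda>_. UNIV \<times> topspace Y))"
      by (intro image_eqI[of _ _ "(length w, restrict ((!) w) {..<length w})"]) auto
    then show ?thesis by (simp add: free_monoid_top_def L o_def)
  qed
  moreover have "w \<in> lists (UNIV \<times> topspace Y)" if "w \<in> topspace (free_monoid_top Y)" for w
  proof -
    have "w \<in> (\<lambda>(n, f). map f [0..<n]) ` Sigma UNIV (\<lambda>n. PiE {..<n} (\<lambda>_. UNIV \<times> topspace Y))"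
      using that by (simp add: free_monoid_top_def L o_def)
    then obtain p where w: "w = (\<lambda>(n, f). map f [0..<n]) p"
      and p: "p \<in> Sigma UNIV (\<lambda>n. PiE {..<n} (\<lambda>_. UNIV \<times> topspace Y))"
      unfolding image_iff by (elim bexE) (rule that)
    have "snd p i \<in> UNIV \<times> topspace Y" if "i < fst p" for i
    proof -
      have "snd p \<in> PiE {..<fst p} (\<lambda>_. UNIV \<times> topspace Y)"
        using p by (metis SigmaE fst_conv snd_conv)
      from PiE_mem[OF this, of i] that show ?thesis by (simp only: lessThan_iff)
    qed
    moreover have "set w = snd p ` {..<fst p}"
      unfolding w by (simp add: case_prod_unfold lessThan_atLeast0)
    ultimately have "set w \<subseteq> UNIV \<times> topspace Y"
      by (simp only: image_subset_iff lessThan_iff Ball_def) iprover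
    then show ?thesis by (intro in_listsI ballI) (rule subsetD)
  qed
  ultimately show ?thesis by (intro equalityI subsetI)
qed

lemma topspace_free_group_top:
  "topspace (free_group_top X) = carrier (free_group (path_components_of X))"
proof -
  let ?P = "\<lambda>(e :: bool, x). (e, path_component_of_set X x)"
  let ?W = "lists (UNIV \<times> topspace X)"
  let ?F = "free_monoid_top X"
  have "?P ` (UNIV \<times> topspace X) = (UNIV :: bool set) \<times> path_component_of_set X ` topspace X"
    by (force simp: image_iff)
  then have "map ?P ` ?W = lists (UNIV \<times> path_components_of X)"
    by (simp only: path_components_of_def flip: lists_image)
  moreover have "word_components X ` path_components_of ?F = map ?P ` ?W"
    unfolding path_components_of_def[of ?F] image_image topspace_free_monoid_top[symmetric]
    by (rule image_cong[OF refl word_components_path_component])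
  then have "topspace (free_group_top X) = reduce_word ` (map ?P ` ?W)"
    by (simp only: free_group_top_def topspace_quotient_topology topspace_pi0_top image_comp[symmetric])
  ultimately have top: "topspace (free_group_top X) = reduce_word ` lists (UNIV \<times> path_components_of X)"
    by (simp only:)
  show ?thesis
  proof -
    have "reduce_word ` L = {w \<in> L. reduced_word w}" if "\<And>w. w \<in> L \<Longrightarrow> reduce_word w \<in> L"
      for L :: "(bool \<times> 'a set) list set"
    proof (intro equalityI subsetI)
      fix w assume "w \<in> {w \<in> L. reduced_word w}"
      then show "w \<in> reduce_word ` L" by (metis (lifting) imageI mem_Collect_eq reduce_word_eq)
    qed (use that reduce_word_reduced in blast)
    from this[OF reduce_word_lists] show ?thesis
      using top by (simp only: free_group_def partial_object.simps)
  qed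
qed

end

theory Submission
  imports Defs
begin

text \<open>
  Write \<open>u\<^sub>w\<close> for the loop of \<open>\<Sigma>(X\<^sub>+)\<close> obtained by concatenating the loops \<open>u\<^sub>x\<close> and their reverses
  along a word \<open>w\<close> over \<open>X\<close>. The map \<open>w \<mapsto> u\<^sub>w\<close> is continuous from the free topological monoid to
  the loop space, and \<open>[u\<^sub>w]\<close> is the image under \<open>h\<^sub>X\<close> of the reduced word of path components of \<open>w\<close>.
  So everything follows once \<open>w \<mapsto> [u\<^sub>w]\<close> is known to be a quotient map that identifies only words
  with the same reduction.

  Quotient map: subdivide a loop \<open>\<alpha>\<close> so finely that every piece either stays in \<open>X \<times> (0, 1)\<close> or avoids
  the levels in a small interval \<open>[a, b]\<close>, chosen to contain the level of no subdivision point.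
  Every loop \<open>\<beta>\<close> near \<open>\<alpha>\<close> has the same pattern. Stretching \<open>[a, b]\<close> to \<open>[0, 1]\<close> deforms \<open>\<beta>\<close> to a
  product of loops of the form \<open>u\<^sub>x\<close>, its reverse, or a null-homotopic loop, where \<open>x\<close> is the
  \<open>X\<close>-coordinate of \<open>\<beta>\<close> at a subdivision point. So \<open>[\<beta>] = [u\<^sub>w]\<close> with \<open>w\<close> depending continuously on \<open>\<beta>\<close>.

  Injectivity: on a fine enough grid, the crossings of level \<open>1/2\<close> by a loop, with their signs and
  path components, spell a word. Each square of a grid on a homotopy lies in \<open>X \<times> (0, 1)\<close> or avoids
  level \<open>1/2\<close>, so moving across it does not change the reduced word. For \<open>u\<^sub>w\<close> the word is that of \<open>w\<close>.
\<close>

section \<open>The homomorphism on arbitrary words\<close>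

lemma carrier_pi1: "carrier (pi1 Z z) = loop_class Z z ` topspace (loop_space Z z)"
  by (simp add: pi1_def)

lemma one_pi1: "\<one>\<^bsub>pi1 Z z\<^esub> = loop_class Z z (\<lambda>t\<in>{0..1}. z)"
  by (simp add: pi1_def)

lemma group_susp_pi1: "group (susp_pi1 X)"
  by (rule group_pi1[OF susp_base_in])

lemma susp_gen_closed:
  assumes "P \<in> path_components_of X"
  shows "susp_gen X P \<in> carrier (susp_pi1 X)"
  using assms by (auto simp: path_components_of_def susp_gen_path_component carrier_pi1 susp_loop_in)

lemma susp_hom_Nil [simp]: "susp_hom X [] = \<one>\<^bsub>susp_pi1 X\<^esub>"
  by (simp add: susp_hom_def)

lemma susp_hom_Cons:
  "susp_hom X ((e, P) # w) =
    (if e then susp_gen X P else inv\<^bsub>susp_pi1 X\<^esub> susp_gen X P) \<otimes>\<^bsub>susp_pi1 X\<^esub> susp_hom X w"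
  by (simp add: susp_hom_def)

lemma susp_hom_closed:
  assumes "w \<in> lists (UNIV \<times> path_components_of X)"
  shows "susp_hom X w \<in> carrier (susp_pi1 X)"
proof -
  interpret G: group "susp_pi1 X" by (rule group_susp_pi1)
  show ?thesis
    using assms by (induction w) (auto simp: susp_hom_Cons susp_gen_closed)
qed

lemma susp_hom_append:
  assumes "v \<in> lists (UNIV \<times> path_components_of X)" "w \<in> lists (UNIV \<times> path_components_of X)"
  shows "susp_hom X (v @ w) = susp_hom X v \<otimes>\<^bsub>susp_pi1 X\<^esub> susp_hom X w"
proof -
  interpret G: group "susp_pi1 X" by (rule group_susp_pi1)
  show ?thesis
    using assms(1)
  proof (induction v)
    case (Cons a v)
    obtain e P where a: "a = (e, P)" by fastforce
    have "P \<in> path_components_of X" "v \<in> lists (UNIV \<times> path_components_of X)"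
      using Cons a by auto
    then show ?case
      using Cons.IH susp_gen_closed[of P X] susp_hom_closed[of v X] susp_hom_closed[OF assms(2)]
      by (auto simp: a susp_hom_Cons G.m_assoc simp del: in_lists_conv_set)
  qed (use susp_hom_closed[OF assms(2)] in simp)
qed

lemma susp_hom_cons_reduce:
  assumes a: "a \<in> UNIV \<times> path_components_of X" and w: "w \<in> lists (UNIV \<times> path_components_of X)"
  shows "susp_hom X (cons_reduce a w) = susp_hom X (a # w)"
proof (cases w)
  case (Cons b v)
  interpret G: group "susp_pi1 X" by (rule group_susp_pi1)
  obtain e P where aP: "a = (e, P)" by fastforce
  obtain e' P' where bP: "b = (e', P')" by fastforce
  have "P \<in> path_components_of X" "v \<in> lists (UNIV \<times> path_components_of X)"
    using a w aP Cons by auto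
  then show ?thesis
    using susp_gen_closed[of P X] susp_hom_closed[of v X]
    by (auto simp: Cons aP bP susp_hom_Cons G.m_assoc[symmetric])
qed simp

text \<open>A cancelling pair contributes mutually inverse factors, so reduction can be postponed:
  products may be computed on unreduced words. Multiplicativity follows.\<close>

lemma susp_hom_reduce_word:
  assumes "w \<in> lists (UNIV \<times> path_components_of X)"
  shows "susp_hom X (reduce_word w) = susp_hom X w"
  using assms
proof (induction w)
  case (Cons a w)
  then have "susp_hom X (cons_reduce a (reduce_word w)) = susp_hom X (a # reduce_word w)"
    by (intro susp_hom_cons_reduce reduce_word_lists) auto
  then show ?case
    using Cons by (cases a) (simp add: reduce_word_def susp_hom_Cons)
qed (simp add: reduce_word_def)

lemma susp_hom_hom:
  "susp_hom X \<in> hom (free_group (path_components_of X)) (susp_pi1 X)"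
  by (rule homI) (auto simp: free_group_def susp_hom_closed susp_hom_reduce_word susp_hom_append)


section \<open>Points, open sets and level changes of the suspension\<close>

text \<open>A point outside the collapsed set is its own fibre under \<open>susp_proj\<close>, hence
  a singleton. For \<open>U\<close> inside \<open>X\<close> and \<open>J\<close> inside (0, 1) this
  is the image of the product of \<open>U\<close> and \<open>J\<close>.\<close>

definition susp_box :: "'a set \<Rightarrow> real set \<Rightarrow> ('a option \<times> real) set set" where
  "susp_box U J = (\<lambda>(x, t). {(Some x, t)}) ` (U \<times> J)"

text \<open>Together with \<open>susp_lev\<close>, the coordinates on the strip over (0, 1). At the
  base point, which is not a singleton, both values are unspecified.\<close>

definition susp_pt :: "('a option \<times> real) set \<Rightarrow> 'a" where
  "susp_pt z = the (fst (the_elem z))"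

definition susp_lev :: "('a option \<times> real) set \<Rightarrow> real" where
  "susp_lev z = snd (the_elem z)"

abbreviation susp_strip :: "'a topology \<Rightarrow> ('a option \<times> real) set set" where
  "susp_strip X \<equiv> susp_box (topspace X) {0<..<1}"

text \<open>For closed \<open>K\<close> inside (0, 1) this is an open neighbourhood of the base
  point; with the strip it forms the two-set covers used below.\<close>

definition susp_off :: "'a topology \<Rightarrow> real set \<Rightarrow> ('a option \<times> real) set set" where
  "susp_off X K = topspace (suspension_plus X) - susp_box (topspace X) K"

lemma susp_pt_lev [simp]: "susp_pt {(Some x, t)} = x" "susp_lev {(Some x, t)} = t"
  by (simp_all add: susp_pt_def susp_lev_def)

lemma susp_box_iff [simp]: "{(Some x, t)} \<in> susp_box U J \<longleftrightarrow> x \<in> U \<and> t \<in> J"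
  by (auto simp: susp_box_def)

lemma susp_boxE:
  assumes "z \<in> susp_box U J"
  obtains x t where "z = {(Some x, t)}" "x \<in> U" "t \<in> J"
  using assms by (auto simp: susp_box_def)

lemma susp_box_mono: "U \<subseteq> V \<Longrightarrow> J \<subseteq> K \<Longrightarrow> susp_box U J \<subseteq> susp_box V K"
  unfolding susp_box_def by (intro image_mono Sigma_mono)

lemma susp_proj_inner:
  "0 < t \<Longrightarrow> t < 1 \<Longrightarrow> susp_proj X (Some x, t) = {(Some x, t)}"
  by (auto simp: susp_proj_def susp_collapsed_def)

lemma susp_proj_ends:
  "x \<in> topspace X \<Longrightarrow> t = 0 \<or> t = 1 \<Longrightarrow> susp_proj X (Some x, t) = susp_base X"
  by (auto simp: susp_proj_def susp_collapsed_def)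

lemma susp_proj_None: "0 \<le> t \<Longrightarrow> t \<le> 1 \<Longrightarrow> susp_proj X (None, t) = susp_base X"
  by (auto simp: susp_proj_def susp_collapsed_def)

lemma susp_base_neq_singleton [simp]:
  "susp_base X \<noteq> {(Some x, t)}" "{(Some x, t)} \<noteq> susp_base X"
proof -
  have "(None, 0) \<in> susp_base X" by (simp add: susp_collapsed_def)
  moreover have "(None, 0) \<notin> {(Some x, t)}" by simp
  ultimately show "susp_base X \<noteq> {(Some x, t)}" "{(Some x, t)} \<noteq> susp_base X" by metis+
qed

lemma susp_base_not_box [simp]: "susp_base X \<notin> susp_box U J"
  by (auto elim: susp_boxE)

lemma topspace_suspension_plus:
  "topspace (suspension_plus X) = insert (susp_base X) (susp_strip X)"
proof (intro equalityI subsetI)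
  fix z assume "z \<in> topspace (suspension_plus X)"
  then have "z \<in> susp_proj X ` (insert None (Some ` topspace X) \<times> {0..1})"
    by (simp add: suspension_plus_def)
  then obtain y t where y: "y \<in> insert None (Some ` topspace X)" "t \<in> {0..1}"
    and z: "z = susp_proj X (y, t)"
    by (elim imageE SigmaE) simp
  then show "z \<in> insert (susp_base X) (susp_strip X)"
    by (cases "t = 0 \<or> t = 1") (auto simp: susp_proj_None susp_proj_ends susp_proj_inner)
next
  fix z assume "z \<in> insert (susp_base X) (susp_strip X)"
  then show "z \<in> topspace (suspension_plus X)"
  proof
    assume "z \<in> susp_strip X"
    then obtain x t where z: "z = {(Some x, t)}" "x \<in> topspace X" "0 < t" "t < 1"
      by (auto elim: susp_boxE)
    then have "z = susp_proj X (Some x, t)" by (simp add: susp_proj_inner)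
    then show ?thesis using z by (auto simp: suspension_plus_def)
  qed (simp add: susp_base_in)
qed

lemma openin_susp_preimage:
  assumes "U \<subseteq> topspace (suspension_plus X)"
    and "openin (prod_topology (plus_topology X) (top_of_set {0..1})) W"
    and "\<And>y t. y \<in> insert None (Some ` topspace X) \<Longrightarrow> 0 \<le> t \<Longrightarrow> t \<le> 1 \<Longrightarrow>
          susp_proj X (y, t) \<in> U \<longleftrightarrow> (y, t) \<in> W"
  shows "openin (suspension_plus X) U"
proof -
  let ?T = "prod_topology (plus_topology X) (top_of_set {0..1::real})"
  have "{p \<in> topspace ?T. susp_proj X p \<in> U} = W"
    using assms(3) openin_subset[OF assms(2)] by (auto simp: subset_iff)
  then show ?thesis
    using assms(1,2) by (simp add: suspension_plus_def openin_quotient_topology)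
qed

lemma openin_plus_topology_Some: "openin X U \<Longrightarrow> openin (plus_topology X) (Some ` U)"
  by (simp add: openin_plus_topology image_iff)

lemma openin_susp_box:
  assumes U: "openin X U" and J: "open J" "J \<subseteq> {0<..<1}"
  shows "openin (suspension_plus X) (susp_box U J)"
proof (rule openin_susp_preimage)
  have "openin (top_of_set {0..1}) ({0..1} \<inter> J)" using J(1) by (rule openin_open_Int)
  moreover have "{0..1} \<inter> J = J" using J(2) by auto
  ultimately show "openin (prod_topology (plus_topology X) (top_of_set {0..1})) (Some ` U \<times> J)"
    using openin_plus_topology_Some[OF U] by (simp add: openin_prod_Times_iff)
  show "susp_box U J \<subseteq> topspace (suspension_plus X)"
    using susp_box_mono[OF openin_subset[OF U] J(2)] by (auto simp: topspace_suspension_plus)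
  fix y :: "'a option" and t :: real assume y: "y \<in> insert None (Some ` topspace X)" and t: "0 \<le> t" "t \<le> 1"
  show "susp_proj X (y, t) \<in> susp_box U J \<longleftrightarrow> (y, t) \<in> Some ` U \<times> J"
  proof (cases "y = None \<or> t = 0 \<or> t = 1")
    case True
    then have "susp_proj X (y, t) = susp_base X"
      using y t by (auto simp: susp_proj_None susp_proj_ends)
    then show ?thesis using True J(2) by auto
  next
    case False
    then show ?thesis using t by (auto simp: susp_proj_inner)
  qed
qed

lemma openin_susp_off:
  assumes K: "closed K" "K \<subseteq> {0<..<1}"
  shows "openin (suspension_plus X) (susp_off X K)"
proof (rule openin_susp_preimage)
  let ?P = "plus_topology X" and ?I = "top_of_set {0..1::real}"
  have "openin ?I ({0..1} \<inter> - K)" using K(1) by (intro openin_open_Int) auto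
  moreover have "openin ?P {None}" by (simp add: openin_plus_topology)
  moreover have "openin ?P (insert None (Some ` topspace X))" using openin_topspace[of ?P] by simp
  moreover have "openin ?I {0..1}" using openin_topspace[of ?I] by simp
  \<comment> \<open>The arc over \<open>None\<close> is collapsed entirely, so its levels in
    \<open>K\<close> belong to the preimage too. As \<open>None\<close> is isolated, adding the arc
    keeps the set open.\<close>
  ultimately show "openin (prod_topology ?P ?I)
      (insert None (Some ` topspace X) \<times> ({0..1} \<inter> - K) \<union> {None} \<times> {0..1})"
    by (intro openin_Un) (simp_all only: openin_prod_Times_iff simp_thms)
  show "susp_off X K \<subseteq> topspace (suspension_plus X)" by (auto simp: susp_off_def)
  fix y :: "'a option" and t :: real assume y: "y \<in> insert None (Some ` topspace X)" and t: "0 \<le> t" "t \<le> 1"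
  show "susp_proj X (y, t) \<in> susp_off X K \<longleftrightarrow>
     (y, t) \<in> insert None (Some ` topspace X) \<times> ({0..1} \<inter> - K) \<union> {None} \<times> {0..1}"
  proof (cases "y = None \<or> t = 0 \<or> t = 1")
    case True
    then have "susp_proj X (y, t) = susp_base X"
      using y t by (auto simp: susp_proj_None susp_proj_ends)
    then show ?thesis using True K(2) y t by (auto simp: susp_off_def susp_base_in)
  next
    case False
    then show ?thesis using y t
      by (auto simp: susp_proj_inner susp_off_def topspace_suspension_plus)
  qed
qed

lemma continuous_map_susp_pt:
  "continuous_map (subtopology (suspension_plus X) (susp_strip X)) X susp_pt"
  unfolding continuous_map_def
proof (intro conjI allI impI)
  show "susp_pt \<in> topspace (subtopology (suspension_plus X) (susp_strip X)) \<rightarrow> topspace X"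
    by (auto elim!: susp_boxE)
  fix U assume U: "openin X U"
  have "{z \<in> topspace (subtopology (suspension_plus X) (susp_strip X)). susp_pt z \<in> U}
      = susp_box U {0<..<1}"
    using susp_box_mono[OF openin_subset[OF U] order_refl, of "{0<..<1}"]
    by (auto simp: topspace_suspension_plus elim!: susp_boxE)
  moreover have "openin (subtopology (suspension_plus X) (susp_strip X)) (susp_box U {0<..<1})"
    unfolding openin_subtopology
    using susp_box_mono[OF openin_subset[OF U] order_refl, of "{0<..<1}"]
      openin_susp_box[OF U, of "{0<..<1}"]
    by (intro exI[of _ "susp_box U {0<..<1}"]) auto
  ultimately show "openin (subtopology (suspension_plus X) (susp_strip X))
      {z \<in> topspace (subtopology (suspension_plus X) (susp_strip X)). susp_pt z \<in> U}" by simp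
qed

lemma continuous_map_susp_lev:
  "continuous_map (subtopology (suspension_plus X) (susp_strip X)) euclideanreal susp_lev"
  unfolding continuous_map_def
proof (intro conjI allI impI)
  fix J :: "real set" assume J: "openin euclidean J"
  have eq: "{z \<in> topspace (subtopology (suspension_plus X) (susp_strip X)). susp_lev z \<in> J}
      = susp_box (topspace X) (J \<inter> {0<..<1})"
    by (auto simp: topspace_suspension_plus elim!: susp_boxE)
  have "openin (suspension_plus X) (susp_box (topspace X) (J \<inter> {0<..<1}))"
    using J by (intro openin_susp_box) auto
  then show "openin (subtopology (suspension_plus X) (susp_strip X))
      {z \<in> topspace (subtopology (suspension_plus X) (susp_strip X)). susp_lev z \<in> J}"
    unfolding eq openin_subtopology
    by (intro exI[of _ "susp_box (topspace X) (J \<inter> {0<..<1})"]) (auto elim!: susp_boxE)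
qed simp

text \<open>The map of the suspension induced by \<open>r\<close> on levels. The base point is
  treated apart because it has no coordinates.\<close>

definition susp_relevel ::
    "'a topology \<Rightarrow> (real \<Rightarrow> real) \<Rightarrow> ('a option \<times> real) set \<Rightarrow> ('a option \<times> real) set" where
  "susp_relevel X r z =
     (if z = susp_base X then susp_base X else susp_proj X (Some (susp_pt z), r (susp_lev z)))"

lemma susp_relevel_proj:
  assumes "y \<in> insert None (Some ` topspace X)" "0 \<le> t" "t \<le> 1" "r 0 = 0" "r 1 = 1" "0 \<le> r t" "r t \<le> 1"
  shows "susp_relevel X r (susp_proj X (y, t)) = susp_proj X (y, r t)"
proof (cases "y = None \<or> t = 0 \<or> t = 1")
  case True
  have "susp_proj X (y, t) = susp_base X"
    using True assms(1-3) by (auto simp: susp_proj_None susp_proj_ends)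
  moreover have "susp_proj X (y, r t) = susp_base X"
    using True
  proof (elim disjE)
    assume "y = None"
    then show ?thesis using assms by (simp add: susp_proj_None)
  qed (use assms(1,4,5) in \<open>auto simp: susp_proj_None susp_proj_ends\<close>)
  ultimately show ?thesis by (simp add: susp_relevel_def)
next
  case False
  then obtain x where "y = Some x" by (cases y) auto
  with False show ?thesis using assms(2,3) by (simp add: susp_proj_inner susp_relevel_def)
qed

lemma continuous_map_susp_proj:
  "continuous_map (prod_topology (plus_topology X) (top_of_set {0..1})) (suspension_plus X) (susp_proj X)"
  unfolding suspension_plus_def
  by (rule quotient_imp_continuous_map[OF quotient_map_quotient_topology])

text \<open>Since \<open>[0, 1]\<close> is locally compact, its product with the quotient map onto the suspension is
  again a quotient map; this is what makes the level homotopy continuous at the base point.\<close>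

lemma continuous_map_susp_relevel:
  assumes r: "continuous_on ({0..1} \<times> {0..1}) r" "r \<in> {0..1} \<times> {0..1} \<rightarrow> {0..1}"
    and r01: "\<And>s. s \<in> {0..1} \<Longrightarrow> r (s, 0) = 0" "\<And>s. s \<in> {0..1} \<Longrightarrow> r (s, 1) = 1"
  shows "continuous_map (prod_topology (top_of_set {0..1::real}) (suspension_plus X)) (suspension_plus X)
     (\<lambda>(s, z). susp_relevel X (\<lambda>t. r (s, t)) z)"
proof -
  let ?I = "top_of_set {0..1::real}"
  let ?T = "prod_topology (plus_topology X) ?I"
  have "locally_compact_space ?I" by (intro compact_imp_locally_compact_space compact_space_subtopology) simp
  then have q: "quotient_map (prod_topology ?I ?T) (prod_topology ?I (suspension_plus X))
      (\<lambda>(s, p). (s, susp_proj X p))"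
    unfolding suspension_plus_def
    by (intro quotient_map_prod_right quotient_map_quotient_topology) (auto simp: Hausdorff_space_subtopology)
  show ?thesis
  proof (rule continuous_compose_quotient_map[OF q])
    let ?f = "\<lambda>x::real \<times> 'a option \<times> real. (fst (snd x), r (fst x, snd (snd x)))"
    have 1: "continuous_map (prod_topology ?I ?T) (plus_topology X) (fst \<circ> snd)"
      "continuous_map (prod_topology ?I ?T) ?I (snd \<circ> snd)"
      by (rule continuous_map_compose[OF continuous_map_snd], rule continuous_map_fst continuous_map_snd)+
    have "continuous_map (prod_topology ?I ?T) (prod_topology ?I ?I) (\<lambda>x. (fst x, (snd \<circ> snd) x))"
      by (rule continuous_map_pairedI[OF continuous_map_fst 1(2)])
    moreover have "continuous_map (prod_topology ?I ?I) ?I r"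
      using r by (auto simp: continuous_map_in_subtopology)
    ultimately have "continuous_map (prod_topology ?I ?T) ?I (r \<circ> (\<lambda>x. (fst x, (snd \<circ> snd) x)))"
      by (rule continuous_map_compose)
    from continuous_map_pairedI[OF 1(1) this]
    have "continuous_map (prod_topology ?I ?T) ?T ?f" by (simp add: o_def)
    from continuous_map_compose[OF this continuous_map_susp_proj]
    have "continuous_map (prod_topology ?I ?T) (suspension_plus X) (susp_proj X \<circ> ?f)" .
    then show "continuous_map (prod_topology ?I ?T) (suspension_plus X)
        ((\<lambda>(s, z). susp_relevel X (\<lambda>t. r (s, t)) z) \<circ> (\<lambda>(s, p). (s, susp_proj X p)))"
      by (rule continuous_map_eq) (use r r01 in \<open>auto simp: susp_relevel_proj Pi_iff\<close>)
  qed
qed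


section \<open>Loops\<close>

lemma loop_ends: "p \<in> topspace (loop_space Z z) \<Longrightarrow> p 0 = z \<and> p 1 = z"
  by (simp add: topspace_loop_space)

lemma loop_in_topspace:
  "p \<in> topspace (loop_space Z z) \<Longrightarrow> t \<in> {0..1} \<Longrightarrow> p t \<in> topspace Z"
  by (auto simp: topspace_loop_space pathin_def continuous_map_def Pi_iff)

lemma loop_continuous_map:
  "p \<in> topspace (loop_space Z z) \<Longrightarrow> continuous_map (top_of_set {0..1}) Z p"
  by (simp add: topspace_loop_space pathin_def)

lemma pi1_inv_class:
  assumes p: "p \<in> topspace (loop_space Z z)" and z: "z \<in> topspace Z"
  shows "inv\<^bsub>pi1 Z z\<^esub> loop_class Z z p = loop_class Z z (\<lambda>t\<in>{0..1}. p (1 - t))"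
proof -
  interpret G: group "pi1 Z z" by (rule group_pi1[OF z])
  let ?r = "\<lambda>t\<in>{0..1}. p (1 - t)"
  note r = loop_reverse_in[OF p] and c = const_loop_in[OF z] and p01 = loop_ends[OF p]
  \<comment> \<open>Running \<open>p\<close> backwards and then forwards is \<open>p\<close> along
    the parameter |1 - 2t|, which starts and ends at 1 and so contracts to the constant 1.\<close>
  have "loop_class Z z (loop_concat ?r p) = loop_class Z z (\<lambda>t\<in>{0..1}. z)"
  proof (rule loop_reparametrize_class[OF p, of "\<lambda>t. \<bar>1 - 2 * t\<bar>" "\<lambda>t. 1"])
    show "loop_concat ?r p t = p \<bar>1 - 2 * t\<bar>" if "t \<in> {0..1}" for t
      using that by (auto simp: loop_concat_def abs_if)
    show "continuous_on {0..1} (\<lambda>t::real. \<bar>1 - 2 * t\<bar>)" by (intro continuous_intros)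
  qed (use p01 c loop_concat_in[OF r p] in auto)
  then have "loop_class Z z ?r \<otimes>\<^bsub>pi1 Z z\<^esub> loop_class Z z p = \<one>\<^bsub>pi1 Z z\<^esub>"
    by (simp add: pi1_mult_class[OF r p] one_pi1)
  then show ?thesis
    by (rule G.inv_equality) (use p r in \<open>auto simp: carrier_pi1\<close>)
qed

section \<open>Cutting a loop at equally spaced times\<close>

definition loop_piece :: "(real \<Rightarrow> 'a) \<Rightarrow> nat \<Rightarrow> nat \<Rightarrow> real \<Rightarrow> 'a" where
  "loop_piece p n i = (\<lambda>t\<in>{0..1}. p ((real i + t) / real n))"

lemma loop_piece_in:
  assumes p: "p \<in> topspace (loop_space Z z)"
    and z: "p (real i / real n) = z" "p (real (Suc i) / real n) = z" and i: "i < n"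
  shows "loop_piece p n i \<in> topspace (loop_space Z z)"
proof -
  have "continuous_map (top_of_set {0..1}) Z (\<lambda>t. p ((real i + t) / real n))"
  proof (rule loop_space_continuous_map[OF p])
    have "0 \<le> (real i + t) / real n \<and> (real i + t) / real n \<le> 1" if "0 \<le> t" "t \<le> 1" for t
      using i that by (auto simp: divide_simps)
    then show "continuous_map (top_of_set {0..1}) (top_of_set {0..1}) (\<lambda>t. (real i + t) / real n)"
      using i by (auto simp: continuous_map_in_subtopology intro!: continuous_intros)
  qed
  then have "continuous_map (top_of_set {0..1}) Z (loop_piece p n i)"
    by (rule continuous_map_eq) (simp add: loop_piece_def)
  then show ?thesis
    using z by (auto simp: topspace_loop_space pathin_def loop_piece_def add.commute)
qed

text \<open>The first piece is split off; the remainder, rescaled to the unit interval, is at the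
  base point at all points of the coarser grid, so the induction hypothesis applies.\<close>

lemma loop_class_pieces:
  assumes z: "z \<in> topspace Z" and n: "n > 0"
    and p: "p \<in> topspace (loop_space Z z)" "\<And>i. i \<le> n \<Longrightarrow> p (real i / real n) = z"
  shows "loop_class Z z p =
    foldr (\<lambda>i g. loop_class Z z (loop_piece p n i) \<otimes>\<^bsub>pi1 Z z\<^esub> g) [0..<n] \<one>\<^bsub>pi1 Z z\<^esub>"
  using n p
proof (induction n arbitrary: p rule: nat_induct_non_zero)
  case 1
  interpret G: group "pi1 Z z" by (rule group_pi1[OF z])
  have "loop_piece p 1 0 = p"
    using 1(1) by (auto simp: loop_piece_def topspace_loop_space fun_eq_iff extensional_def)
  then show ?case using 1(1) by (simp add: carrier_pi1)
next
  case (Suc n)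
  let ?N = "real (Suc n)"
  let ?q = "\<lambda>t\<in>{0..1}. p ((1 + real n * t) / ?N)"
  let ?p0 = "loop_piece p (Suc n) 0"
  have p: "p \<in> topspace (loop_space Z z)" by (rule Suc.prems)
  have p0: "?p0 \<in> topspace (loop_space Z z)"
    by (rule loop_piece_in[OF p]) (use Suc.prems(2)[of 0] Suc.prems(2)[of 1] in auto)
  have q: "?q \<in> topspace (loop_space Z z)"
  proof -
    have "continuous_map (top_of_set {0..1}) Z (\<lambda>t. p ((1 + real n * t) / ?N))"
    proof (rule loop_space_continuous_map[OF p])
      have "0 \<le> (1 + real n * t) / ?N \<and> (1 + real n * t) / ?N \<le> 1" if "0 \<le> t" "t \<le> 1" for t
        using that mult_left_le[of t "real n"] by (auto simp: divide_simps)
      then show "continuous_map (top_of_set {0..1}) (top_of_set {0..1}) (\<lambda>t. (1 + real n * t) / ?N)"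
        by (auto simp: continuous_map_in_subtopology intro!: continuous_intros)
    qed
    then have "continuous_map (top_of_set {0..1}) Z ?q"
      by (rule continuous_map_eq) simp
    then show ?thesis
      using Suc.prems(2)[of 1] Suc.prems(2)[of "Suc n"] Suc.hyps
      by (auto simp: topspace_loop_space pathin_def)
  qed
  have "?q (real i / real n) = z" if "i \<le> n" for i
    using Suc.prems(2)[of "Suc i"] that Suc.hyps by (auto simp: divide_simps)
  note IH = Suc.IH[OF q this]
  have piece: "loop_piece ?q n i = loop_piece p (Suc n) (Suc i)" if "i < n" for i
  proof (rule ext)
    fix t :: real
    have "0 \<le> (real i + t) / real n \<and> (real i + t) / real n \<le> 1" if "0 \<le> t" "t \<le> 1"
      using \<open>i < n\<close> that by (auto simp: divide_simps)
    then show "loop_piece ?q n i t = loop_piece p (Suc n) (Suc i) t"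
      using Suc.hyps by (auto simp: loop_piece_def add_ac)
  qed
  \<comment> \<open>The time change from \<open>p\<close> to the concatenation is piecewise linear
    with a break at 1/2. Its second slope is at least its first, so it is the maximum of its two
    linear parts, and continuity is immediate.\<close>
  let ?f = "\<lambda>t. max (2 * t / ?N) ((1 + real n * (2 * t - 1)) / ?N)"
  have le: "2 * t \<le> 1 + real n * (2 * t - 1)" if "1/2 \<le> t" for t
    using mult_right_mono[of 1 "real n" "2 * t - 1"] Suc.hyps that by simp
  have ge: "1 + real n * (2 * t - 1) \<le> 2 * t" if "t \<le> 1/2" for t
    using mult_right_mono_neg[of 1 "real n" "2 * t - 1"] Suc.hyps that by simp
  have "loop_class Z z (loop_concat ?p0 ?q) = loop_class Z z p"
  proof (rule loop_reparametrize_class[OF p, of ?f "\<lambda>t. t"])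
    show "loop_concat ?p0 ?q t = p (?f t)" if t: "t \<in> {0..1}" for t
    proof (cases "t \<le> 1/2")
      case True
      then have "?f t = 2 * t / ?N" using ge[OF True] by (simp add: max_def divide_simps)
      then show ?thesis using True t by (simp add: loop_concat_def loop_piece_def)
    next
      case False
      then have "?f t = (1 + real n * (2 * t - 1)) / ?N" using le[of t] by (simp add: max_def divide_simps)
      then show ?thesis using False t by (simp add: loop_concat_def)
    qed
    show "continuous_on {0..1} ?f" by (intro continuous_intros) auto
    have "0 \<le> ?f t \<and> ?f t \<le> 1" if t: "0 \<le> t" "t \<le> 1" for t
    proof -
      have "real n * (2 * t - 1) \<le> real n" "2 * t \<le> 1 + real n"
        using mult_left_mono[of "2 * t - 1" 1 "real n"] t Suc.hyps by auto
      then show ?thesis using t by (simp add: max_def divide_simps)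
    qed
    then show "?f \<in> {0..1} \<rightarrow> {0..1}" by auto
    have "(1 + real n * (2 * 0 - 1)) \<le> 0" using Suc.hyps by simp
    then show "?f 0 = 0" by (simp add: max_def divide_simps)
    show "?f 1 = 1" using le[of 1] by (simp add: max_def divide_simps)
    then show "p (?f 1) = z" using loop_ends[OF p] by simp
    show "p (?f 0) = z" using \<open>?f 0 = 0\<close> loop_ends[OF p] by simp
  qed (use p loop_concat_in[OF p0 q] in auto)
  then have "loop_class Z z p = loop_class Z z ?p0 \<otimes>\<^bsub>pi1 Z z\<^esub> loop_class Z z ?q"
    by (simp only: pi1_mult_class[OF p0 q])
  also have "loop_class Z z ?q = foldr (\<lambda>i g. loop_class Z z (loop_piece p (Suc n) (Suc i)) \<otimes>\<^bsub>pi1 Z z\<^esub> g)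
      [0..<n] \<one>\<^bsub>pi1 Z z\<^esub>"
    by (rule trans[OF IH], assumption) (rule foldr_cong; simp only: piece set_upt atLeastLessThan_iff)
  also have "\<dots> = foldr (\<lambda>i g. loop_class Z z (loop_piece p (Suc n) i) \<otimes>\<^bsub>pi1 Z z\<^esub> g)
      [Suc 0..<Suc n] \<one>\<^bsub>pi1 Z z\<^esub>"
    by (simp only: map_Suc_upt[symmetric] foldr_map o_def)
  finally show ?case by (simp only: upt_conv_Cons[OF zero_less_Suc] foldr.simps o_apply)
qed

text \<open>The linear homotopy from the identity to \<open>r\<close> fixes the levels 0 and 1
  throughout, so it induces a deformation of the suspension that fixes the base point.\<close>

lemma loop_class_susp_relevel:
  assumes p: "p \<in> topspace (loop_space (suspension_plus X) (susp_base X))"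
    and r: "continuous_on {0..1} r" "r \<in> {0..1} \<rightarrow> {0..1}" "r 0 = 0" "r 1 = 1"
  shows "(\<lambda>t\<in>{0..1}. susp_relevel X r (p t)) \<in> topspace (loop_space (suspension_plus X) (susp_base X))"
      (is "?q \<in> _")
    and "loop_class (suspension_plus X) (susp_base X) (\<lambda>t\<in>{0..1}. susp_relevel X r (p t)) =
      loop_class (suspension_plus X) (susp_base X) p"
proof -
  let ?I = "top_of_set {0..1::real}" and ?Z = "suspension_plus X"
  let ?r = "\<lambda>(s, t). (1 - s) * t + s * r t"
  let ?h = "\<lambda>(s, t). susp_relevel X (\<lambda>u. ?r (s, u)) (p t)"
  have rI: "?r x \<in> {0..1}" if "x \<in> {0..1} \<times> {0..1}" for x
  proof -
    have "(1 - fst x) *\<^sub>R snd x + fst x *\<^sub>R r (snd x) \<in> {0..1}"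
      by (rule convexD[OF convex_real_interval(5)]) (use that r in auto)
    then show ?thesis by (simp add: case_prod_unfold)
  qed
  have rc: "continuous_on ({0..1} \<times> {0..1}) ?r"
    unfolding case_prod_unfold
    by (intro continuous_intros continuous_on_compose2[OF r(1)]) auto
  have "continuous_map (prod_topology ?I ?I) (prod_topology ?I ?Z) (\<lambda>x. (fst x, p (snd x)))"
    by (intro continuous_map_pairedI continuous_map_fst loop_space_continuous_map[OF p] continuous_map_snd)
  from continuous_map_compose[OF this continuous_map_susp_relevel[OF rc]]
  have h: "continuous_map (prod_topology ?I ?I) ?Z ?h"
    using rI r(3,4) by (simp add: o_def case_prod_unfold)
  have id: "susp_relevel X (\<lambda>u. u) z = z" if "z \<in> topspace ?Z" for z
    using that by (auto simp: topspace_suspension_plus susp_relevel_def susp_proj_inner elim!: susp_boxE)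
  have base: "susp_relevel X f (susp_base X) = susp_base X" for f by (simp add: susp_relevel_def)
  have "continuous_map ?I ?Z (?h \<circ> Pair 1)"
    using continuous_map_o_Pair[OF h, of 1] by simp
  then have "continuous_map ?I ?Z ?q"
    by (rule continuous_map_eq) simp
  then show q: "?q \<in> topspace (loop_space ?Z (susp_base X))"
    using loop_ends[OF p] by (auto simp: topspace_loop_space pathin_def base)
  have "loop_homotopic ?Z (susp_base X) p ?q"
    unfolding loop_homotopic_iff
    using h loop_ends[OF p] by (intro exI[of _ ?h]) (auto simp: id loop_in_topspace[OF p] base)
  then show "loop_class ?Z (susp_base X) ?q = loop_class ?Z (susp_base X) p"
    using loop_class_eq_iff[OF p q] by simp
qed


section \<open>The loop of a word\<close>

abbreviation word_path_components :: "'a topology \<Rightarrow> (bool \<times> 'a) list \<Rightarrow> (bool \<times> 'a set) list" where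
  "word_path_components X \<equiv> map (\<lambda>(e, x). (e, path_component_of_set X x))"

definition letter_loop :: "'a topology \<Rightarrow> bool \<times> 'a \<Rightarrow> real \<Rightarrow> ('a option \<times> real) set" where
  "letter_loop X a = (\<lambda>t\<in>{0..1}. susp_proj X (Some (snd a), if fst a then t else 1 - t))"

text \<open>The concatenation is nested to the right: the letters take up 1/2, 1/4, ... of the time
  and the constant loop fills the rest.\<close>

definition word_loop :: "'a topology \<Rightarrow> (bool \<times> 'a) list \<Rightarrow> real \<Rightarrow> ('a option \<times> real) set" where
  "word_loop X w = foldr (\<lambda>a. loop_concat (letter_loop X a)) w (\<lambda>t\<in>{0..1}. susp_base X)"

lemma word_path_components_lists:
  "w \<in> lists (UNIV \<times> topspace X) \<Longrightarrow> word_path_components X w \<in> lists (UNIV \<times> path_components_of X)"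
  by (induction w) (auto simp: path_components_of_def)

lemma word_loop_Nil: "word_loop X [] = (\<lambda>t\<in>{0..1}. susp_base X)"
  by (simp only: word_loop_def foldr.simps id_apply)

lemma word_loop_Cons: "word_loop X (a # w) = loop_concat (letter_loop X a) (word_loop X w)"
  by (simp only: word_loop_def foldr.simps o_apply)

lemma letter_loop_True: "letter_loop X (True, x) = susp_loop X x"
  by (simp add: letter_loop_def susp_loop_def)

lemma letter_loop_False: "letter_loop X (False, x) = (\<lambda>t\<in>{0..1}. susp_loop X x (1 - t))"
  unfolding letter_loop_def susp_loop_def by (rule restrict_ext) simp

lemma letter_loop_in:
  assumes "x \<in> topspace X"
  shows "letter_loop X (e, x) \<in> topspace (loop_space (suspension_plus X) (susp_base X))"
  using susp_loop_in[OF assms] loop_reverse_in[OF susp_loop_in[OF assms]]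
  by (cases e) (simp_all only: letter_loop_True letter_loop_False)

lemma loop_class_letter_loop:
  assumes x: "x \<in> topspace X"
  shows "loop_class (suspension_plus X) (susp_base X) (letter_loop X (e, x)) =
    susp_hom X [(e, path_component_of_set X x)]"
proof -
  interpret G: group "susp_pi1 X" by (rule group_susp_pi1)
  have gen: "susp_gen X (path_component_of_set X x) \<in> carrier (susp_pi1 X)"
    using x by (intro susp_gen_closed) (simp add: path_components_of_def)
  show ?thesis
    using gen G.inv_closed[OF gen] pi1_inv_class[OF susp_loop_in[OF x] susp_base_in] susp_gen_path_component[OF x]
    by (cases e) (simp_all del: restrict_apply add: susp_hom_Cons letter_loop_True letter_loop_False)
qed

lemma word_loop_in:
  assumes "w \<in> lists (UNIV \<times> topspace X)"
  shows "word_loop X w \<in> topspace (loop_space (suspension_plus X) (susp_base X))"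
  using assms
  by (induction w)
    (auto simp: word_loop_Nil word_loop_Cons const_loop_in susp_base_in letter_loop_in
      simp del: restrict_apply intro!: loop_concat_in)

text \<open>Concatenation becomes multiplication, letter by letter. With
  \<open>susp_hom_reduce_word\<close> this shows that the class depends only on the reduced word of
  components.\<close>

lemma loop_class_word_loop:
  assumes "w \<in> lists (UNIV \<times> topspace X)"
  shows "loop_class (suspension_plus X) (susp_base X) (word_loop X w) =
    susp_hom X (word_path_components X w)"
  using assms
proof (induction w)
  case Nil
  show ?case by (simp add: word_loop_Nil one_pi1 del: restrict_apply)
next
  case (Cons a w)
  interpret G: group "susp_pi1 X" by (rule group_susp_pi1)
  obtain e x where a: "a = (e, x)" by fastforce
  have x: "x \<in> topspace X" and w: "w \<in> lists (UNIV \<times> topspace X)" using Cons a by auto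
  have "susp_hom X [(e, path_component_of_set X x)] \<otimes>\<^bsub>susp_pi1 X\<^esub> susp_hom X (word_path_components X w)
      = susp_hom X ((e, path_component_of_set X x) # word_path_components X w)"
    using susp_hom_append[of "[(e, path_component_of_set X x)]" X "word_path_components X w"]
      word_path_components_lists[OF w] x
    by (simp add: path_components_of_def del: in_lists_conv_set)
  then show ?case
    using Cons.IH pi1_mult_class[OF letter_loop_in[OF x, of e] word_loop_in[OF w]]
    by (simp add: a word_loop_Cons loop_class_letter_loop[OF x])
qed

section \<open>Continuity of the passage from words to loops, and of maps into words\<close>

lemma continuous_map_from_sum_topology:
  assumes "\<And>i. i \<in> I \<Longrightarrow> continuous_map (Y i) Z (\<lambda>x. f (i, x))"
  shows "continuous_map (sum_topology Y I) Z f"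
  unfolding continuous_map_def
proof (intro conjI allI impI)
  show "f \<in> topspace (sum_topology Y I) \<rightarrow> topspace Z"
    using assms by (auto simp: continuous_map_def Pi_iff)
  fix U assume U: "openin Z U"
  have "{x. (i, x) \<in> {y \<in> topspace (sum_topology Y I). f y \<in> U}} = {x \<in> topspace (Y i). f (i, x) \<in> U}"
    if "i \<in> I" for i using that by auto
  then show "openin (sum_topology Y I) {y \<in> topspace (sum_topology Y I). f y \<in> U}"
    using openin_continuous_map_preimage[OF assms U] by (simp only: openin_sum_topology) auto
qed

text \<open>Currying needs no assumption on \<open>Y\<close>, by the tube lemma.\<close>

lemma continuous_map_loop_space:
  assumes F: "continuous_map (prod_topology Y (top_of_set {0..1})) Z (\<lambda>(y, t). F y t)"
    and in_loop: "\<And>y. y \<in> topspace Y \<Longrightarrow> F y \<in> topspace (loop_space Z z)"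
  shows "continuous_map Y (loop_space Z z) F"
proof -
  let ?I = "top_of_set {0..1::real}"
  have Fy: "F y \<in> extensional {0..1}" "continuous_map ?I Z (F y)" "F y 0 = z" "F y 1 = z"
    if "y \<in> topspace Y" for y
    using in_loop[OF that] by (auto simp: topspace_loop_space pathin_def)
  have "continuous_map Y (compact_open_topology ?I Z) F"
    unfolding compact_open_topology_def
  proof (rule continuous_on_generated_topo)
    fix W assume "W \<in> {{f \<in> extensional (topspace ?I). continuous_map ?I Z f \<and> f ` K \<subseteq> U} | K U.
          compactin ?I K \<and> openin Z U}"
    then obtain K U where W: "W = {f \<in> extensional (topspace ?I). continuous_map ?I Z f \<and> f ` K \<subseteq> U}"
      and K: "compactin ?I K" and U: "openin Z U" by blast
    have K1: "K \<subseteq> {0..1}" using compactin_subset_topspace[OF K] by simp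
    let ?O = "{x \<in> topspace (prod_topology Y ?I). (\<lambda>(y, t). F y t) x \<in> U}"
    have O: "openin (prod_topology Y ?I) ?O"
      by (rule openin_continuous_map_preimage[OF F U])
    have eq: "F -` W \<inter> topspace Y = {y \<in> topspace Y. \<forall>s\<in>K. F y s \<in> U}"
      using Fy K1 by (auto simp: W image_subset_iff)
    show "openin Y (F -` W \<inter> topspace Y)"
    proof (subst openin_subopen, intro ballI)
      fix y assume "y \<in> F -` W \<inter> topspace Y"
      then have y: "y \<in> topspace Y" "\<forall>s\<in>K. F y s \<in> U" unfolding eq by auto
      then have "{y} \<times> K \<subseteq> ?O" using K1 by auto
      then obtain A B where AB: "openin Y A" "y \<in> A" "K \<subseteq> B" "A \<times> B \<subseteq> ?O"
        using tube_lemma_right[OF O K, of y] y by auto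
      have "F r s \<in> U" if "r \<in> A" "s \<in> K" for r s
      proof -
        have "(r, s) \<in> ?O" using AB(3,4) that by blast
        then show ?thesis by simp
      qed
      then have "A \<subseteq> {y \<in> topspace Y. \<forall>s\<in>K. F y s \<in> U}"
        using openin_subset[OF AB(1)] by auto
      then show "\<exists>T. openin Y T \<and> y \<in> T \<and> T \<subseteq> F -` W \<inter> topspace Y"
        unfolding eq using AB by blast
    qed
  next
    have "F ` topspace Y \<subseteq> topspace (compact_open_topology ?I Z)"
      using Fy by auto
    then show "F ` topspace Y \<subseteq> \<Union> {{f \<in> extensional (topspace ?I). continuous_map ?I Z f \<and> f ` K \<subseteq> U} | K U.
          compactin ?I K \<and> openin Z U}"
      unfolding compact_open_topology_def topology_generated_by_topspace .
  qed
  then show ?thesis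
    using Fy by (auto simp: loop_space_def continuous_map_in_subtopology)
qed

lemma continuous_map_letter_loop:
  "continuous_map (prod_topology (letter_space X) (top_of_set {0..1})) (suspension_plus X)
     (\<lambda>(a, t). letter_loop X a t)"
proof -
  let ?I = "top_of_set {0..1::real}"
  \<comment> \<open>The level \<open>t\<close> or \<open>1 - t\<close>, selected by an indicator of
    the sign. The sign is locally constant on the letter space, so the formula is
    continuous.\<close>
  let ?l = "\<lambda>y. of_bool (fst (fst y)) * snd y + (1 - of_bool (fst (fst y))) * (1 - snd y)"
  have "continuous_map (letter_space X) X snd"
    unfolding letter_space_def by (rule continuous_map_from_sum_topology) simp
  from continuous_map_compose[OF continuous_map_fst this]
  have 1: "continuous_map (prod_topology (letter_space X) ?I) X (\<lambda>y. snd (fst y))"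
    by (simp add: o_def)
  have "continuous_map (letter_space X) euclideanreal (\<lambda>a. of_bool (fst a))"
    unfolding letter_space_def by (rule continuous_map_from_sum_topology) simp
  from continuous_map_compose[OF continuous_map_fst this]
  have 2: "continuous_map (prod_topology (letter_space X) ?I) euclideanreal (\<lambda>y. of_bool (fst (fst y)))"
    by (simp add: o_def)
  have 3: "continuous_map (prod_topology (letter_space X) ?I) euclideanreal snd"
    using continuous_map_snd[of "letter_space X" ?I] by (simp add: continuous_map_in_subtopology)
  have "continuous_map (prod_topology (letter_space X) ?I) euclideanreal ?l"
    by (intro continuous_map_add continuous_map_real_mult continuous_map_diff 2 3) simp_all
  then have "continuous_map (prod_topology (letter_space X) ?I) ?I ?l"
    by (auto simp: continuous_map_in_subtopology)
  from continuous_map_compose[OF continuous_map_pairedI[OF 1 this] susp_strip_continuous]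
  show ?thesis
    by (rule continuous_map_eq) (auto simp: letter_loop_def)
qed

text \<open>The letters are continuous functions of a parameter, so the induction can treat the tail
  as a word depending on the same parameter. Head and tail are glued at time 1/2, where both are at
  the base point.\<close>

lemma continuous_map_word_loop_eval:
  assumes "\<forall>g\<in>set gs. continuous_map Y (letter_space X) g"
  shows "continuous_map (prod_topology Y (top_of_set {0..1})) (suspension_plus X)
     (\<lambda>(y, t). word_loop X (map (\<lambda>g. g y) gs) t)"
  using assms
proof (induction gs)
  case Nil
  have "continuous_map (prod_topology Y (top_of_set {0..1::real})) (suspension_plus X) (\<lambda>_. susp_base X)"
    by (simp add: susp_base_in)
  then show ?case by (rule continuous_map_eq) (auto simp: word_loop_Nil)
next
  case (Cons g gs)
  let ?I = "top_of_set {0..1::real}" and ?Z = "suspension_plus X"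
  let ?YI = "prod_topology Y ?I"
  let ?w = "\<lambda>y. map (\<lambda>g. g y) gs"
  have g: "continuous_map Y (letter_space X) g" using Cons.prems by simp
  have top: "g y \<in> UNIV \<times> topspace X" if "g \<in> set gs" "y \<in> topspace Y" for g y
    using Cons.prems continuous_map_image_subset_topspace[of Y "letter_space X" g] that
    by (force simp: letter_space_def)
  have gtop: "snd (g y) \<in> topspace X" if "y \<in> topspace Y" for y
    using continuous_map_image_subset_topspace[OF g] that by (force simp: letter_space_def)
  have w: "word_loop X (?w y) \<in> topspace (loop_space ?Z (susp_base X))" if "y \<in> topspace Y" for y
  proof (intro word_loop_in in_listsI ballI)
    fix a assume "a \<in> set (?w y)"
    then show "a \<in> UNIV \<times> topspace X" using top that by (simp only: set_map) blast
  qed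
  have "continuous_map ?YI ?Z (\<lambda>x. if snd x \<le> 1/2 then letter_loop X (g (fst x)) (2 * snd x)
      else word_loop X (?w (fst x)) (2 * snd x - 1))"
  proof (rule continuous_map_cases_le)
    have "continuous_map (subtopology ?YI {x. x \<in> topspace ?YI \<and> snd x \<le> 1/2})
        (prod_topology (letter_space X) ?I) (\<lambda>x. (g (fst x), 2 * snd x))"
    proof (rule continuous_map_pairedI)
      show "continuous_map (subtopology ?YI {x. x \<in> topspace ?YI \<and> snd x \<le> 1/2}) (letter_space X) (\<lambda>x. g (fst x))"
        by (rule continuous_map_from_subtopology) (rule continuous_map_compose[OF continuous_map_fst g, unfolded o_def])
      have "continuous_map ?YI euclideanreal (\<lambda>x. 2 * snd x)"
        using continuous_map_snd[of Y ?I] by (intro continuous_map_real_mult) (auto simp: continuous_map_in_subtopology)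
      then show "continuous_map (subtopology ?YI {x. x \<in> topspace ?YI \<and> snd x \<le> 1/2}) ?I (\<lambda>x. 2 * snd x)"
        by (auto simp: continuous_map_in_subtopology continuous_map_from_subtopology)
    qed
    from continuous_map_compose[OF this continuous_map_letter_loop]
    show "continuous_map (subtopology ?YI {x. x \<in> topspace ?YI \<and> snd x \<le> 1/2}) ?Z
        (\<lambda>x. letter_loop X (g (fst x)) (2 * snd x))" by (simp add: o_def)
    have "continuous_map (subtopology ?YI {x. x \<in> topspace ?YI \<and> 1/2 \<le> snd x}) ?YI (\<lambda>x. (fst x, 2 * snd x - 1))"
    proof (rule continuous_map_pairedI)
      show "continuous_map (subtopology ?YI {x. x \<in> topspace ?YI \<and> 1/2 \<le> snd x}) Y fst"
        by (rule continuous_map_from_subtopology) (rule continuous_map_fst)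
      have "continuous_map ?YI euclideanreal (\<lambda>x. 2 * snd x - 1)"
        using continuous_map_snd[of Y ?I]
        by (intro continuous_map_real_mult continuous_map_diff) (auto simp: continuous_map_in_subtopology)
      then show "continuous_map (subtopology ?YI {x. x \<in> topspace ?YI \<and> 1/2 \<le> snd x}) ?I (\<lambda>x. 2 * snd x - 1)"
        by (auto simp: continuous_map_in_subtopology continuous_map_from_subtopology)
    qed
    from continuous_map_compose[OF this Cons.IH] Cons.prems
    show "continuous_map (subtopology ?YI {x. x \<in> topspace ?YI \<and> 1/2 \<le> snd x}) ?Z
        (\<lambda>x. word_loop X (?w (fst x)) (2 * snd x - 1))" by (simp add: o_def)
    show "continuous_map ?YI euclideanreal snd"
      using continuous_map_snd[of Y ?I] by (simp add: continuous_map_in_subtopology)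
    fix x assume x: "x \<in> topspace ?YI" "snd x = 1/2"
    then have "letter_loop X (g (fst x)) 1 = susp_base X"
      using letter_loop_in[OF gtop, of "fst x" "fst (g (fst x))"] loop_ends by fastforce
    moreover have "word_loop X (?w (fst x)) 0 = susp_base X"
      using loop_ends[OF w, of "fst x"] x by auto
    ultimately show "letter_loop X (g (fst x)) (2 * snd x) = word_loop X (?w (fst x)) (2 * snd x - 1)"
      unfolding x(2) by simp
  qed simp
  then show ?case
    by (rule continuous_map_eq) (auto simp: word_loop_Cons loop_concat_def)
qed

lemma continuous_map_word_loop:
  "continuous_map (free_monoid_top X) (loop_space (suspension_plus X) (susp_base X)) (word_loop X)"
  unfolding free_monoid_top_def
proof (rule continuous_compose_quotient_map[OF quotient_map_quotient_topology],
    rule continuous_map_from_sum_topology)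
  fix n :: nat
  let ?P = "product_topology (\<lambda>_. letter_space X) {..<n}"
  \<comment> \<open>The coordinate projections: evaluated at \<open>f\<close> they spell the word
    that \<open>f\<close> encodes.\<close>
  let ?gs = "map (\<lambda>i (f :: nat \<Rightarrow> bool \<times> 'a). f i) [0..<n]"
  have eq: "map (\<lambda>g. g f) ?gs = map f [0..<n]" for f by simp
  have "continuous_map ?P (loop_space (suspension_plus X) (susp_base X)) (\<lambda>f. word_loop X (map (\<lambda>g. g f) ?gs))"
  proof (rule continuous_map_loop_space)
    show "continuous_map (prod_topology ?P (top_of_set {0..1})) (suspension_plus X)
        (\<lambda>(f, t). word_loop X (map (\<lambda>g. g f) ?gs) t)"
      by (rule continuous_map_word_loop_eval) (auto intro!: continuous_map_product_projection)
    show "word_loop X (map (\<lambda>g. g f) ?gs) \<in> topspace (loop_space (suspension_plus X) (susp_base X))"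
      if "f \<in> topspace ?P" for f
      unfolding eq using that by (intro word_loop_in) (force simp: letter_space_def PiE_iff)
  qed
  then show "continuous_map ?P (loop_space (suspension_plus X) (susp_base X))
      (\<lambda>f. (word_loop X \<circ> (\<lambda>(n, f). map f [0..<n])) (n, f))"
    unfolding eq by (simp only: o_apply case_prod_conv)
qed

text \<open>The length of the word is fixed, so the map lands in a single summand, where continuity
  is checked coordinatewise.\<close>

lemma continuous_map_into_free_monoid_top:
  assumes "\<forall>g\<in>set gs. continuous_map Y (letter_space X) g"
  shows "continuous_map Y (free_monoid_top X) (\<lambda>y. map (\<lambda>g. g y) gs)"
proof -
  let ?n = "length gs"
  have "continuous_map Y (product_topology (\<lambda>_. letter_space X) {..<?n}) (\<lambda>y. \<lambda>i\<in>{..<?n}. (gs ! i) y)"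
    unfolding continuous_map_componentwise
  proof (intro conjI ballI)
    fix i assume i: "i \<in> {..<?n}"
    then have "continuous_map Y (letter_space X) (gs ! i)" using assms by simp
    then show "continuous_map Y (letter_space X) (\<lambda>y. (\<lambda>i\<in>{..<?n}. (gs ! i) y) i)"
      by (rule continuous_map_eq) (use i in simp)
  qed auto
  from continuous_map_compose[OF this
      continuous_map_component_injection[of ?n UNIV "\<lambda>n. product_topology (\<lambda>_. letter_space X) {..<n}"]]
  have "continuous_map Y (sum_topology (\<lambda>n. product_topology (\<lambda>_. letter_space X) {..<n}) UNIV)
      ((\<lambda>f. (?n, f)) \<circ> (\<lambda>y. \<lambda>i\<in>{..<?n}. (gs ! i) y))" by simp
  from continuous_map_compose[OF this quotient_imp_continuous_map[OF quotient_map_quotient_topology]]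
  show ?thesis
    unfolding free_monoid_top_def
    by (rule continuous_map_eq) (auto intro: nth_equalityI)
qed


section \<open>Local sections of the class map on words\<close>

text \<open>A homotopy slides the \<open>X\<close>-coordinate back to \<open>x 0\<close> while
  straightening the level to an affine path. The ends, at level 0 or 1, stay at the base point; what
  remains is a constant loop, a generator loop or its reverse.\<close>

lemma loop_class_strip_path:
  assumes x: "continuous_map (top_of_set {0..1}) X x"
    and l: "continuous_on {0..1} l" "l \<in> {0..1} \<rightarrow> {0..1}" "l 0 \<in> {0, 1}" "l 1 \<in> {0, 1}"
    and q: "q = (\<lambda>t\<in>{0..1::real}. susp_proj X (Some (x t), l t))"
  shows "loop_class (suspension_plus X) (susp_base X) q =
    susp_hom X (if l 0 = l 1 then [] else [(l 1 = 1, path_component_of_set X (x 0))])"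
proof -
  let ?I = "top_of_set {0..1::real}" and ?Z = "suspension_plus X"
  let ?m = "\<lambda>t. (1 - t) * l 0 + t * l 1"
  let ?h = "\<lambda>y. susp_proj X (Some (x ((1 - fst y) * snd y)), (1 - fst y) * l (snd y) + fst y * ?m (snd y))"
  let ?q' = "\<lambda>t\<in>{0..1}. susp_proj X (Some (x 0), ?m t)"
  have xX: "x t \<in> topspace X" if "t \<in> {0..1}" for t
    using x that by (auto simp: continuous_map_def Pi_iff)
  have cvx: "(1 - s) * u + s * v \<in> {0..1}" if "s \<in> {0..1}" "u \<in> {0..1}" "v \<in> {0..1}" for s u v :: real
  proof -
    have "(1 - s) *\<^sub>R u + s *\<^sub>R v \<in> {0..1}"
      by (rule convexD[OF convex_real_interval(5)]) (use that in auto)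
    then show ?thesis by simp
  qed
  have mI: "?m t \<in> {0..1}" if "t \<in> {0..1}" for t
    using l that by (intro cvx) auto
  have "continuous_map (prod_topology ?I ?I) ?I (\<lambda>y. (1 - fst y) * snd y)"
    using cvx[of _ _ 0] by (auto simp: continuous_map_in_subtopology mult_le_one intro!: continuous_intros)
  from continuous_map_compose[OF this x]
  have 1: "continuous_map (prod_topology ?I ?I) X (\<lambda>y. x ((1 - fst y) * snd y))" by (simp add: o_def)
  have "continuous_on ({0..1} \<times> {0..1}) (\<lambda>y. (1 - fst y) * l (snd y) + fst y * ?m (snd y))"
    by (intro continuous_intros continuous_on_compose2[OF l(1)]) auto
  moreover have "(1 - fst y) * l (snd y) + fst y * ?m (snd y) \<in> {0..1}" if "y \<in> {0..1} \<times> {0..1}" for y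
    using that l(2) by (intro cvx mI) auto
  ultimately have "continuous_map (prod_topology ?I ?I) ?I (\<lambda>y. (1 - fst y) * l (snd y) + fst y * ?m (snd y))"
    by (simp add: continuous_map_in_subtopology Pi_iff del: atLeastAtMost_iff)
  from continuous_map_compose[OF continuous_map_pairedI[OF 1 this] susp_strip_continuous]
  have h: "continuous_map (prod_topology ?I ?I) ?Z ?h" by (simp add: o_def)
  have ends: "?h (s, 0) = susp_base X" "?h (s, 1) = susp_base X" if "s \<in> {0..1}" for s
  proof -
    have "(1 - s) * l 0 + s * ?m 0 = l 0" "(1 - s) * l 1 + s * ?m 1 = l 1" by (simp_all add: algebra_simps)
    then show "?h (s, 0) = susp_base X" "?h (s, 1) = susp_base X"
      using l(3,4) that xX by (auto simp: susp_proj_ends)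
  qed
  have in_loop: "(\<lambda>t\<in>{0..1}. ?h (s, t)) \<in> topspace (loop_space ?Z (susp_base X))" if s: "s \<in> {0..1}" for s
  proof -
    have "continuous_map ?I ?Z (?h \<circ> Pair s)"
      using continuous_map_o_Pair[OF h, of s] s by simp
    then have "continuous_map ?I ?Z (\<lambda>t\<in>{0..1}. ?h (s, t))" by (rule continuous_map_eq) simp
    then show ?thesis using ends[OF s] by (auto simp: topspace_loop_space pathin_def)
  qed
  have q0: "(\<lambda>t\<in>{0..1}. ?h (0, t)) = q" unfolding q by (rule restrict_ext) simp
  have q1: "(\<lambda>t\<in>{0..1}. ?h (1, t)) = ?q'" by (rule restrict_ext) simp
  have "loop_homotopic ?Z (susp_base X) q ?q'"
    unfolding loop_homotopic_iff
    by (intro exI[of _ ?h] conjI ballI) (use h ends q in \<open>auto\<close>)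
  then have "loop_class ?Z (susp_base X) q = loop_class ?Z (susp_base X) ?q'"
    using in_loop[of 0] in_loop[of 1] unfolding q0 q1 by (simp add: loop_class_eq_iff)
  also have "\<dots> = susp_hom X (if l 0 = l 1 then [] else [(l 1 = 1, path_component_of_set X (x 0))])"
  proof (cases "l 0 = l 1")
    case True
    \<comment> \<open>With equal ends the level is constantly 0 or 1, so the whole path is collapsed
      to the base point.\<close>
    have "?m t = l 1" for t using True by (simp add: algebra_simps)
    then have "?q' = (\<lambda>t\<in>{0..1}. susp_base X)"
      using l(4) xX[of 0] by (intro restrict_ext) (auto simp: susp_proj_ends)
    then show ?thesis using True by (simp add: one_pi1 del: restrict_apply)
  next
    case False
    then have "?q' = letter_loop X (l 1 = 1, x 0)"
      unfolding letter_loop_def using l(3,4) by (intro restrict_ext) auto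
    then show ?thesis using False loop_class_letter_loop[OF xX[of 0], of "l 1 = 1"] by simp
  qed
  finally show ?thesis .
qed

section \<open>Loops of a fixed shape on a grid\<close>

definition grid_interval :: "nat \<Rightarrow> nat \<Rightarrow> real set" where
  "grid_interval n i = {real i / real n..real (Suc i) / real n}"

lemma grid_interval_subset: "i < n \<Longrightarrow> grid_interval n i \<subseteq> {0..1}"
  by (auto simp: grid_interval_def divide_simps)

lemma grid_interval_ends: "real i / real n \<in> grid_interval n i" "real (Suc i) / real n \<in> grid_interval n i"
  by (auto simp: grid_interval_def divide_right_mono)

lemma grid_interval_param:
  "i < n \<Longrightarrow> t \<in> {0..1} \<Longrightarrow> (real i + t) / real n \<in> grid_interval n i"
  by (auto simp: grid_interval_def divide_right_mono)

lemma openin_loop_space_image: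
  assumes "compact K" "K \<subseteq> {0..1}" "openin Z U"
  shows "openin (loop_space Z z) {p \<in> topspace (loop_space Z z). p ` K \<subseteq> U}"
proof -
  let ?I = "top_of_set {0..1::real}"
  let ?W = "{f \<in> extensional (topspace ?I). continuous_map ?I Z f \<and> f ` K \<subseteq> U}"
  have "compactin ?I K" using assms by (simp add: compactin_subtopology)
  then have "openin (compact_open_topology ?I Z) ?W"
    unfolding compact_open_topology_def
    by (intro topology_generated_by_Basis) (use assms in blast)
  then show ?thesis
    unfolding loop_space_def openin_subtopology by (intro exI[of _ ?W]) auto
qed

lemma continuous_map_loop_eval:
  assumes "t \<in> {0..1}"
  shows "continuous_map (loop_space Z z) Z (\<lambda>p. p t)"
  unfolding continuous_map_def
proof (intro conjI allI impI)
  fix U assume "openin Z U"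
  from openin_loop_space_image[OF _ _ this, of "{t}" z] assms
  show "openin (loop_space Z z) {p \<in> topspace (loop_space Z z). p t \<in> U}" by simp
qed (rule Pi_I, rule loop_in_topspace[OF _ assms])

text \<open>The inequalities are strict and the base point lies on neither side, which makes the
  side of a grid point an open condition on the loop.\<close>

definition susp_half :: "'a topology \<Rightarrow> real \<Rightarrow> real \<Rightarrow> bool \<Rightarrow> ('a option \<times> real) set set" where
  "susp_half X a b e = susp_box (topspace X) (if e then {b<..<1} else {0<..<a})"

text \<open>The loops that look like a given one on a grid: \<open>c i\<close> says that the \<open>i\<close>-th piece runs inside
  \<open>X \<times> (0, 1)\<close>, all other pieces avoid the levels in \<open>[a, b]\<close>, and \<open>s i\<close> records on which side of
  \<open>[a, b]\<close> the \<open>i\<close>-th grid point lies.\<close>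

definition loop_shape ::
    "'a topology \<Rightarrow> nat \<Rightarrow> real \<Rightarrow> real \<Rightarrow> (nat \<Rightarrow> bool) \<Rightarrow> (nat \<Rightarrow> bool) \<Rightarrow>
      (real \<Rightarrow> ('a option \<times> real) set) set" where
  "loop_shape X n a b c s =
     {p \<in> topspace (loop_space (suspension_plus X) (susp_base X)).
       \<forall>i<n. if c i
         then p ` grid_interval n i \<subseteq> susp_strip X \<and> p (real i / real n) \<in> susp_half X a b (s i) \<and>
           p (real (Suc i) / real n) \<in> susp_half X a b (s (Suc i))
         else p ` grid_interval n i \<subseteq> susp_off X {a..b}}"

text \<open>After \<open>[a, b]\<close> is stretched to \<open>[0, 1]\<close>, only pieces in the
  strip that change sides contribute a letter, positive when they end above. The loop enters only
  through its \<open>X\<close>-coordinates at grid points.\<close>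

definition loop_word ::
    "nat \<Rightarrow> (nat \<Rightarrow> bool) \<Rightarrow> (nat \<Rightarrow> bool) \<Rightarrow> (real \<Rightarrow> ('a option \<times> real) set) \<Rightarrow> (bool \<times> 'a) list" where
  "loop_word n c s p =
     map (\<lambda>i. (s (Suc i), susp_pt (p (real i / real n)))) (filter (\<lambda>i. c i \<and> s i \<noteq> s (Suc i)) [0..<n])"

text \<open>The shape is a finite conjunction of subbasic conditions: grid intervals and grid
  points, which are compact, are sent into open sets.\<close>

lemma openin_loop_shape:
  assumes "n > 0" "0 < a" "a < b" "b < 1"
  shows "openin (loop_space (suspension_plus X) (susp_base X)) (loop_shape X n a b c s)"
proof -
  let ?Z = "suspension_plus X"
  let ?L = "loop_space ?Z (susp_base X)"
  have strip: "openin ?Z (susp_strip X)" by (rule openin_susp_box) auto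
  have half: "openin ?Z (susp_half X a b e)" for e
    unfolding susp_half_def using assms by (intro openin_susp_box) auto
  have off: "openin ?Z (susp_off X {a..b})" using assms by (intro openin_susp_off) auto
  note img = openin_loop_space_image[of _ ?Z _ "susp_base X"]
  let ?N = "\<lambda>i. {p \<in> topspace ?L. if c i
         then p ` grid_interval n i \<subseteq> susp_strip X \<and> p (real i / real n) \<in> susp_half X a b (s i) \<and>
           p (real (Suc i) / real n) \<in> susp_half X a b (s (Suc i))
         else p ` grid_interval n i \<subseteq> susp_off X {a..b}}"
  have N: "openin ?L (?N i)" if i: "i < n" for i
  proof (cases "c i")
    case True
    have "?N i = {p \<in> topspace ?L. p ` grid_interval n i \<subseteq> susp_strip X}
        \<inter> {p \<in> topspace ?L. p ` {real i / real n} \<subseteq> susp_half X a b (s i)}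
        \<inter> {p \<in> topspace ?L. p ` {real (Suc i) / real n} \<subseteq> susp_half X a b (s (Suc i))}"
      using True by auto
    moreover have "openin ?L \<dots>"
      by (intro openin_Int img strip half)
        (use i grid_interval_subset[OF i] in \<open>auto simp: grid_interval_def\<close>)
    ultimately show ?thesis by simp
  next
    case False
    then have "?N i = {p \<in> topspace ?L. p ` grid_interval n i \<subseteq> susp_off X {a..b}}" by simp
    moreover have "openin ?L \<dots>"
      by (intro img off) (use grid_interval_subset[OF i] in \<open>auto simp: grid_interval_def\<close>)
    ultimately show ?thesis by simp
  qed
  have "openin ?L ((\<Inter>i\<in>{..<n}. ?N i) \<inter> topspace ?L)"
    by (rule openin_INT) (use N in auto)
  moreover have "(\<Inter>i\<in>{..<n}. ?N i) \<inter> topspace ?L = loop_shape X n a b c s"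
    by (auto simp: loop_shape_def)
  ultimately show ?thesis by simp
qed

text \<open>For a fixed shape the length and signs of the word are constant. Only the
  \<open>X\<close>-coordinates vary, continuously, because the grid points concerned are mapped into
  the strip.\<close>

lemma continuous_map_loop_word:
  "continuous_map (subtopology (loop_space (suspension_plus X) (susp_base X)) (loop_shape X n a b c s))
     (free_monoid_top X) (loop_word n c s)"
proof -
  let ?Z = "suspension_plus X"
  let ?L = "subtopology (loop_space ?Z (susp_base X)) (loop_shape X n a b c s)"
  let ?F = "filter (\<lambda>i. c i \<and> s i \<noteq> s (Suc i)) [0..<n]"
  have "continuous_map ?L (letter_space X) (\<lambda>p. (s (Suc i), susp_pt (p (real i / real n))))"
    if "i < n" "c i" for i
  proof -
    have "real i / real n \<in> {0..1}" using that by (simp add: divide_simps)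
    from continuous_map_from_subtopology[OF continuous_map_loop_eval[OF this]]
    have "continuous_map ?L ?Z (\<lambda>p. p (real i / real n))" .
    moreover have "p (real i / real n) \<in> susp_strip X" if "p \<in> loop_shape X n a b c s" for p
    proof -
      have "p ` grid_interval n i \<subseteq> susp_strip X"
        using that \<open>i < n\<close> \<open>c i\<close> by (auto simp: loop_shape_def)
      then show ?thesis using grid_interval_ends(1) by blast
    qed
    ultimately have "continuous_map ?L (subtopology ?Z (susp_strip X)) (\<lambda>p. p (real i / real n))"
      by (auto simp: continuous_map_in_subtopology)
    from continuous_map_compose[OF this continuous_map_susp_pt]
    have "continuous_map ?L X (\<lambda>p. susp_pt (p (real i / real n)))" by (simp add: o_def)
    from continuous_map_compose[OF this continuous_map_component_injection[of "s (Suc i)" UNIV "\<lambda>_. X"]]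
    show ?thesis by (simp add: letter_space_def o_def)
  qed
  then have "continuous_map ?L (free_monoid_top X)
      (\<lambda>p. map (\<lambda>g. g p) (map (\<lambda>i p. (s (Suc i), susp_pt (p (real i / real n)))) ?F))"
    by (intro continuous_map_into_free_monoid_top) auto
  then show ?thesis by (simp add: loop_word_def[abs_def] o_def)
qed

lemma susp_hom_map_filter:
  assumes "\<And>i. i \<in> set is \<Longrightarrow> Q i \<Longrightarrow> f i \<in> UNIV \<times> path_components_of X"
  shows "foldr (\<lambda>i g. susp_hom X (if Q i then [f i] else []) \<otimes>\<^bsub>susp_pi1 X\<^esub> g) is \<one>\<^bsub>susp_pi1 X\<^esub> =
    susp_hom X (map f (filter Q is))"
  using assms
proof (induction "is")
  case (Cons i "is")
  interpret G: group "susp_pi1 X" by (rule group_susp_pi1)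
  have l: "map f (filter Q is) \<in> lists (UNIV \<times> path_components_of X)"
    using Cons.prems by fastforce
  show ?case
  proof (cases "Q i")
    case True
    then show ?thesis
      using Cons susp_hom_append[of "[f i]" X, OF _ l] by (simp del: in_lists_conv_set)
  next
    case False
    then show ?thesis using Cons susp_hom_closed[OF l] by simp
  qed
qed simp

text \<open>Stretching \<open>[a, b]\<close> to \<open>[0, 1]\<close> sends everything off
  \<open>[a, b]\<close> to the base point, including all grid points. The deformed loop thus splits
  into loops: a piece avoiding \<open>[a, b]\<close> becomes constant, and a piece in the strip is
  evaluated by \<open>loop_class_strip_path\<close>.\<close>

lemma loop_class_loop_word:
  assumes n: "n > 0" and ab: "0 < a" "a < b" "b < 1" and p: "p \<in> loop_shape X n a b c s"
  shows "loop_word n c s p \<in> lists (UNIV \<times> topspace X)"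
    and "loop_class (suspension_plus X) (susp_base X) p =
      susp_hom X (word_path_components X (loop_word n c s p))"
proof -
  let ?I = "top_of_set {0..1::real}" and ?Z = "suspension_plus X"
  \<comment> \<open>The affine map of \<open>[a, b]\<close> onto \<open>[0, 1]\<close>, clamped
    outside \<open>[a, b]\<close>.\<close>
  define r where "r t = max 0 (min 1 ((t - a) / (b - a)))" for t
  have r: "continuous_on A r" "r \<in> {0..1} \<rightarrow> {0..1}" "r 0 = 0" "r 1 = 1" for A
  proof -
    show "continuous_on A r" unfolding r_def by (intro continuous_intros) (use ab in auto)
  qed (use ab in \<open>auto simp: r_def max_def min_def divide_simps\<close>)
  have r_lo: "r t = 0" if "t \<le> a" for t
    using that ab by (auto simp: r_def max_def min_def divide_simps)
  have r_hi: "r t = 1" if "b \<le> t" for t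
    using that ab by (auto simp: r_def max_def min_def divide_simps)
  have pL: "p \<in> topspace (loop_space ?Z (susp_base X))"
    using p by (simp add: loop_shape_def)
  define q where "q = (\<lambda>t\<in>{0..1}. susp_relevel X r (p t))"
  have qL: "q \<in> topspace (loop_space ?Z (susp_base X))"
    and qp: "loop_class ?Z (susp_base X) q = loop_class ?Z (susp_base X) p"
    unfolding q_def using loop_class_susp_relevel[OF pL r] by auto
  have off: "susp_relevel X r z = susp_base X" if "z \<in> susp_off X {a..b}" for z
  proof (cases "z = susp_base X")
    case False
    then have "z \<in> susp_strip X" and nz: "z \<notin> susp_box (topspace X) {a..b}"
      using that by (auto simp: susp_off_def topspace_suspension_plus)
    then obtain x t where z: "z = {(Some x, t)}" "x \<in> topspace X" by (elim susp_boxE)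
    then have "t \<le> a \<or> b \<le> t" using nz by auto
    then have "r t = 0 \<or> r t = 1" using r_lo r_hi by blast
    then show ?thesis using z by (simp add: susp_relevel_def susp_proj_ends)
  qed (simp add: susp_relevel_def)
  have half: "z \<in> susp_off X {a..b} \<and> r (susp_lev z) = of_bool e" if "z \<in> susp_half X a b e" for z e
  proof -
    have "z \<in> susp_box (topspace X) (if e then {b<..<1} else {0<..<a})"
      using that by (simp only: susp_half_def)
    then obtain x t where z: "z = {(Some x, t)}" "x \<in> topspace X" and t: "t \<in> (if e then {b<..<1} else {0<..<a})"
      by (elim susp_boxE)
    have "0 < t" "t < 1" "t \<notin> {a..b}" "r t = of_bool e"
      using t ab r_lo[of t] r_hi[of t] by (auto split: if_splits)
    then show ?thesis using z by (simp add: susp_off_def topspace_suspension_plus)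
  qed
  then have half_off: "susp_half X a b e \<subseteq> susp_off X {a..b}" for e by blast
  have shape_c: "p ` grid_interval n i \<subseteq> susp_strip X \<and> p (real i / real n) \<in> susp_half X a b (s i) \<and>
           p (real (Suc i) / real n) \<in> susp_half X a b (s (Suc i))" if "i < n" "c i" for i
    using p that by (simp add: loop_shape_def del: of_nat_Suc)
  have shape_nc: "p ` grid_interval n i \<subseteq> susp_off X {a..b}" if "i < n" "\<not> c i" for i
    using p that by (simp add: loop_shape_def del: of_nat_Suc)
  have ends_off: "p (real i / real n) \<in> susp_off X {a..b}" "p (real (Suc i) / real n) \<in> susp_off X {a..b}"
    if "i < n" for i
    using shape_c[OF that] shape_nc[OF that] half_off grid_interval_ends[of i n] by (cases "c i"; blast)+
  have q_base: "q (real i / real n) = susp_base X" if "i \<le> n" for i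
  proof (cases "i < n")
    case True
    then show ?thesis using ends_off(1)[of i] by (simp add: q_def off)
  next
    case False
    then show ?thesis using that n loop_ends[OF qL] by simp
  qed
  let ?P = "\<lambda>i. (s (Suc i), path_component_of_set X (susp_pt (p (real i / real n))))"
  let ?Q = "\<lambda>i. c i \<and> s i \<noteq> s (Suc i)"
  have strip_pt: "susp_pt (p t) \<in> topspace X" if "i < n" "c i" "t \<in> grid_interval n i" for i t
    using shape_c[OF that(1,2)] that(3) by (force elim!: susp_boxE)
  have piece: "loop_class ?Z (susp_base X) (loop_piece q n i) = susp_hom X (if ?Q i then [?P i] else [])"
    if i: "i < n" for i
  proof -
    let ?t = "\<lambda>t. (real i + t) / real n"
    have tI: "?t t \<in> {0..1}" if "t \<in> {0..1}" for t
      using grid_interval_param[OF i that] grid_interval_subset[OF i] by blast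
    show ?thesis
    proof (cases "c i")
      case False
      have "loop_piece q n i = (\<lambda>t\<in>{0..1}. susp_base X)"
        unfolding loop_piece_def
      proof (rule restrict_ext)
        fix t :: real assume t: "t \<in> {0..1}"
        then have "p (?t t) \<in> susp_off X {a..b}"
          using shape_nc[OF i False] grid_interval_param[OF i t] by blast
        then show "q (?t t) = susp_base X" using tI[OF t] by (simp add: q_def off del: atLeastAtMost_iff)
      qed
      then show ?thesis using False by (simp add: one_pi1 del: restrict_apply)
    next
      case True
      note sc = shape_c[OF i True]
      have strip: "p (?t t) \<in> susp_strip X" if "t \<in> {0..1}" for t
        using sc grid_interval_param[OF i that] by blast
      have "continuous_map ?I ?I ?t"
        using tI n by (auto simp: continuous_map_in_subtopology simp del: atLeastAtMost_iff intro!: continuous_intros)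
      from loop_space_continuous_map[OF pL this]
      have pt: "continuous_map ?I (subtopology ?Z (susp_strip X)) (\<lambda>t. p (?t t))"
        using strip by (auto simp: continuous_map_in_subtopology)
      let ?l = "\<lambda>t. r (susp_lev (p (?t t)))"
      have "continuous_map ?I euclideanreal (\<lambda>t. susp_lev (p (?t t)))"
        using continuous_map_compose[OF pt continuous_map_susp_lev] by (simp add: o_def)
      then have l: "continuous_on {0..1} ?l"
        by (intro continuous_on_compose2[OF r(1)[of UNIV]]) auto
      have lI: "?l \<in> {0..1} \<rightarrow> {0..1}"
      proof (rule Pi_I)
        fix t :: real assume "t \<in> {0..1}"
        from strip[OF this] have "susp_lev (p (?t t)) \<in> {0..1}" by (elim susp_boxE) simp
        then show "?l t \<in> {0..1}" by (rule funcset_mem[OF r(2)])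
      qed
      \<comment> \<open>The stretched levels at the ends are 0 or 1, so the piece gives a letter
        precisely when \<open>s\<close> changes, with sign \<open>s (Suc i)\<close>.\<close>
      have l0: "?l 0 = of_bool (s i)" and l1: "?l 1 = of_bool (s (Suc i))"
        using sc half by (auto simp: add.commute)
      have q_eq: "loop_piece q n i = (\<lambda>t\<in>{0..1}. susp_proj X (Some (susp_pt (p (?t t))), ?l t))"
        unfolding loop_piece_def
      proof (rule restrict_ext)
        fix t :: real assume t: "t \<in> {0..1}"
        have "p (?t t) \<noteq> susp_base X" using strip[OF t] by auto
        then show "q (?t t) = susp_proj X (Some (susp_pt (p (?t t))), ?l t)"
          using tI[OF t] by (simp add: q_def susp_relevel_def del: atLeastAtMost_iff)
      qed
      have "continuous_map ?I X (\<lambda>t. susp_pt (p (?t t)))"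
        using continuous_map_compose[OF pt continuous_map_susp_pt] by (simp add: o_def)
      from loop_class_strip_path[OF this l lI _ _ q_eq]
      show ?thesis unfolding l0 l1 using True by (cases "s i"; cases "s (Suc i)") simp_all
    qed
  qed
  have Q: "?P i \<in> UNIV \<times> path_components_of X" if "i \<in> set [0..<n]" "?Q i" for i
    using strip_pt[of i "real i / real n"] grid_interval_ends that by (auto simp: path_components_of_def)
  show "loop_word n c s p \<in> lists (UNIV \<times> topspace X)"
    using strip_pt grid_interval_ends by (auto simp: loop_word_def)
  have "loop_class ?Z (susp_base X) q =
     foldr (\<lambda>i g. loop_class ?Z (susp_base X) (loop_piece q n i) \<otimes>\<^bsub>susp_pi1 X\<^esub> g) [0..<n] \<one>\<^bsub>susp_pi1 X\<^esub>"
    by (rule loop_class_pieces[OF susp_base_in n qL]) (rule q_base)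
  also have "\<dots> = foldr (\<lambda>i g. susp_hom X (if ?Q i then [?P i] else []) \<otimes>\<^bsub>susp_pi1 X\<^esub> g) [0..<n] \<one>\<^bsub>susp_pi1 X\<^esub>"
    by (rule foldr_cong[OF refl refl]) (simp only: piece set_upt atLeastLessThan_iff)
  also have "\<dots> = susp_hom X (map ?P (filter ?Q [0..<n]))"
    by (rule susp_hom_map_filter) (rule Q)
  also have "map ?P (filter ?Q [0..<n]) = word_path_components X (loop_word n c s p)"
    by (simp add: loop_word_def)
  finally show "loop_class ?Z (susp_base X) p = susp_hom X (word_path_components X (loop_word n c s p))"
    by (simp only: qp)
qed

section \<open>Existence of a shape for every loop\<close>

lemma Lebesgue_two_sets:
  fixes f :: "'b::metric_space \<Rightarrow> 'c"
  assumes S: "compact S" and f: "continuous_map (top_of_set S) Z f"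
    and A: "openin Z A" and B: "openin Z B" and AB: "topspace Z \<subseteq> A \<union> B"
  obtains \<delta> where "\<delta> > 0" "\<And>T. T \<subseteq> S \<Longrightarrow> diameter T < \<delta> \<Longrightarrow> f ` T \<subseteq> A \<or> f ` T \<subseteq> B"
proof -
  \<comment> \<open>The Lebesgue number lemma asks for open sets of the ambient metric space, so the
    relatively open preimages are extended to such sets.\<close>
  have pre: "\<exists>V. open V \<and> (\<forall>x\<in>S. f x \<in> U \<longleftrightarrow> x \<in> V)" if "openin Z U" for U
  proof -
    obtain V where "open V" and V: "{x \<in> S. f x \<in> U} = S \<inter> V"
      using openin_continuous_map_preimage[OF f \<open>openin Z U\<close>] by (auto simp only: openin_open topspace_euclidean_subtopology)
    have "x \<in> {x \<in> S. f x \<in> U} \<longleftrightarrow> x \<in> V" if "x \<in> S" for x using that by (simp only: V Int_iff simp_thms)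
    then show ?thesis using \<open>open V\<close> by auto
  qed
  obtain V where V: "open V" "\<And>x. x \<in> S \<Longrightarrow> f x \<in> A \<longleftrightarrow> x \<in> V" using pre[OF A] by blast
  obtain W where W: "open W" "\<And>x. x \<in> S \<Longrightarrow> f x \<in> B \<longleftrightarrow> x \<in> W" using pre[OF B] by blast
  have "f x \<in> A \<union> B" if "x \<in> S" for x
    using f AB that by (auto simp: continuous_map_def Pi_iff)
  then have cov: "S \<subseteq> \<Union> {V, W}" using V(2) W(2) by auto
  have op: "open C" if "C \<in> {V, W}" for C using that V(1) W(1) by auto
  show thesis
  proof (rule Lebesgue_number_lemma[OF S insert_not_empty cov op])
    fix \<delta> :: real assume \<delta>: "0 < \<delta>" "\<And>T. T \<subseteq> S \<Longrightarrow> diameter T < \<delta> \<Longrightarrow> \<exists>C\<in>{V, W}. T \<subseteq> C"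
    show thesis
    proof (rule that[OF \<delta>(1)])
      fix T assume T: "T \<subseteq> S" "diameter T < \<delta>"
      then have "T \<subseteq> V \<or> T \<subseteq> W" using \<delta>(2)[OF T] by simp
      then show "f ` T \<subseteq> A \<or> f ` T \<subseteq> B"
      proof
        assume "T \<subseteq> V"
        then show ?thesis using V(2) T(1) by (intro disjI1 image_subsetI) (metis subsetD)
      next
        assume "T \<subseteq> W"
        then show ?thesis using W(2) T(1) by (intro disjI2 image_subsetI) (metis subsetD)
      qed
    qed
  qed
qed

lemma topspace_susp_strip_off: "K \<subseteq> {0<..<1} \<Longrightarrow> topspace (suspension_plus X) \<subseteq> susp_strip X \<union> susp_off X K"
  using susp_box_mono[OF order_refl, of K "{0<..<1}" "topspace X"] by (auto simp: susp_off_def)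

text \<open>An open interval minus a finite set is open and nonempty, so it contains a closed
  interval. This supplies levels \<open>[a, b]\<close> that no grid point takes.\<close>

lemma interval_avoiding_finite:
  fixes u v :: real
  assumes "finite F" "u < v"
  obtains a b where "u < a" "a < b" "b < v" "{a..b} \<inter> F = {}"
proof -
  have "infinite {u<..<v}" using assms(2) by (rule infinite_Ioo)
  then have "\<not> {u<..<v} \<subseteq> F" using assms(1) finite_subset by blast
  then obtain x where x: "x \<in> {u<..<v} - F" by blast
  have "open ({u<..<v} - F)" using assms(1) by (intro open_Diff finite_imp_closed) auto
  then obtain e where e: "e > 0" "cball x e \<subseteq> {u<..<v} - F" using x open_contains_cball by blast
  have sub: "{x - e..x + e} \<subseteq> {u<..<v} - F" using e(2) by (simp add: cball_eq_atLeastAtMost)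
  have "x - e \<in> {x - e..x + e}" "x + e \<in> {x - e..x + e}" using e(1) by auto
  then have "x - e \<in> {u<..<v}" "x + e \<in> {u<..<v}" using sub by blast+
  then show thesis using e(1) sub by (intro that[of "x - e" "x + e"]) auto
qed

lemma loop_has_shape:
  assumes p: "p \<in> topspace (loop_space (suspension_plus X) (susp_base X))"
  obtains n a b c s where "n > 0" "0 < a" "a < b" "b < 1" "p \<in> loop_shape X n a b c s"
proof -
  let ?Z = "suspension_plus X"
  \<comment> \<open>A wide middle band comes first, since the grid must be known before
    \<open>[a, b]\<close> is chosen; pieces that avoid the band also avoid any smaller
    \<open>[a, b]\<close>.\<close>
  have J: "{1/3..2/3} \<subseteq> {0<..<1::real}" by auto
  have strip: "openin ?Z (susp_strip X)" by (rule openin_susp_box) auto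
  have off: "openin ?Z (susp_off X {1/3..2/3})" using J by (intro openin_susp_off) auto
  obtain \<delta> where \<delta>: "\<delta> > 0" "\<And>T. T \<subseteq> {0..1} \<Longrightarrow> diameter T < \<delta> \<Longrightarrow>
      p ` T \<subseteq> susp_strip X \<or> p ` T \<subseteq> susp_off X {1/3..2/3}"
    by (rule Lebesgue_two_sets[OF compact_Icc loop_continuous_map[OF p] strip off topspace_susp_strip_off[OF J]])
      (rule that, assumption+)
  obtain m where "inverse (real (Suc m)) < \<delta>" using reals_Archimedean[OF \<delta>(1)] by blast
  then obtain n where n: "n > 0" "1 / real n < \<delta>"
    using that[of "Suc m"] by (simp add: inverse_eq_divide del: of_nat_Suc)
  have grid: "p ` grid_interval n i \<subseteq> susp_strip X \<or> p ` grid_interval n i \<subseteq> susp_off X {1/3..2/3}"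
    if "i < n" for i
  proof (rule \<delta>(2)[OF grid_interval_subset[OF that]])
    have "real (Suc i) / real n - real i / real n = 1 / real n"
      by (simp add: diff_divide_distrib[symmetric])
    then show "diameter (grid_interval n i) < \<delta>"
      using n \<delta>(1) by (simp add: grid_interval_def diameter_closed_interval divide_right_mono del: of_nat_Suc)
  qed
  \<comment> \<open>At grid points mapped to the base point \<open>susp_lev\<close> is unspecified;
    that is harmless, as \<open>?F\<close> is finite in any case.\<close>
  let ?F = "(\<lambda>i. susp_lev (p (real i / real n))) ` {..n}"
  obtain a b where ab: "1/3 < a" "a < b" "b < 2/3" "{a..b} \<inter> ?F = {}"
    by (rule interval_avoiding_finite[of ?F "1/3" "2/3"]) auto
  \<comment> \<open>Pieces lying in both members of the cover count as strip pieces, so every other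
    piece avoids the band.\<close>
  define c where "c i \<longleftrightarrow> p ` grid_interval n i \<subseteq> susp_strip X" for i
  define s where "s i \<longleftrightarrow> b < susp_lev (p (real i / real n))" for i
  have half: "p (real i / real n) \<in> susp_half X a b (s i)"
    if i: "i \<le> n" and "p (real i / real n) \<in> susp_strip X" for i
  proof -
    obtain x t where z: "p (real i / real n) = {(Some x, t)}" "x \<in> topspace X" "t \<in> {0<..<1}"
      using \<open>p (real i / real n) \<in> susp_strip X\<close> by (elim susp_boxE)
    have "susp_lev (p (real i / real n)) \<in> ?F" using i by auto
    then have "t \<notin> {a..b}" using ab(4) z(1) by auto
    then show ?thesis using z by (auto simp: susp_half_def s_def)
  qed
  have "p \<in> loop_shape X n a b c s"
    unfolding loop_shape_def
  proof (intro CollectI conjI allI impI p)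
    fix i assume i: "i < n"
    show "if c i
         then p ` grid_interval n i \<subseteq> susp_strip X \<and> p (real i / real n) \<in> susp_half X a b (s i) \<and>
           p (real (Suc i) / real n) \<in> susp_half X a b (s (Suc i))
         else p ` grid_interval n i \<subseteq> susp_off X {a..b}"
    proof (cases "c i")
      case True
      then have "p (real i / real n) \<in> susp_strip X" "p (real (Suc i) / real n) \<in> susp_strip X"
        unfolding c_def using grid_interval_ends[where n = n and i = i] by blast+
      then show ?thesis using True half[of i] half[of "Suc i"] i by (simp add: c_def del: of_nat_Suc)
    next
      case False
      then have "p ` grid_interval n i \<subseteq> susp_off X {1/3..2/3}" using grid[OF i] by (simp add: c_def)
      also have "\<dots> \<subseteq> susp_off X {a..b}"
        unfolding susp_off_def using ab by (intro Diff_mono susp_box_mono order_refl) auto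
      finally show ?thesis using False by simp
    qed
  qed
  then show thesis using n(1) ab by (intro that[of n a b c s]) auto
qed

text \<open>Local lifts give the result: near each loop, \<open>loop_word\<close> is a continuous
  map to words that preserves classes. A set of classes with open preimage in words therefore has
  open preimage in loops.\<close>

lemma quotient_map_loop_class_word_loop:
  "quotient_map (free_monoid_top X) (pi1_top (suspension_plus X) (susp_base X))
     (loop_class (suspension_plus X) (susp_base X) \<circ> word_loop X)"
proof -
  let ?Z = "suspension_plus X"
  let ?L = "loop_space ?Z (susp_base X)" and ?M = "free_monoid_top X"
  let ?cl = "loop_class ?Z (susp_base X)"
  have q: "quotient_map ?L (pi1_top ?Z (susp_base X)) ?cl"
    unfolding pi1_top_def by (rule quotient_map_quotient_topology)
  have cont: "continuous_map ?M (pi1_top ?Z (susp_base X)) (?cl \<circ> word_loop X)"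
    by (rule continuous_map_compose[OF continuous_map_word_loop quotient_imp_continuous_map[OF q]])
  have sect: "loop_word n c s p \<in> topspace ?M" "?cl (word_loop X (loop_word n c s p)) = ?cl p"
    if "n > 0" "0 < a" "a < b" "b < 1" "p \<in> loop_shape X n a b c s" for n a b c s p
    using loop_class_loop_word[OF that]
    by (simp_all add: topspace_free_monoid_top loop_class_word_loop del: in_lists_conv_set)
  show ?thesis
    unfolding quotient_map_def
  proof (intro conjI allI impI iffI)
    have "?cl p \<in> (?cl \<circ> word_loop X) ` topspace ?M" if p: "p \<in> topspace ?L" for p
    proof -
      obtain n a b c s where "n > 0" "0 < a" "a < b" "b < 1" "p \<in> loop_shape X n a b c s"
        by (rule loop_has_shape[OF p])
      from sect[OF this] show ?thesis by (metis comp_apply imageI)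
    qed
    then show "(?cl \<circ> word_loop X) ` topspace ?M = topspace (pi1_top ?Z (susp_base X))"
      using continuous_map_image_subset_topspace[OF cont] by (auto simp: topspace_pi1_top carrier_pi1)
  next
    fix U assume "openin (pi1_top ?Z (susp_base X)) U"
    then show "openin ?M {w \<in> topspace ?M. (?cl \<circ> word_loop X) w \<in> U}"
      by (rule openin_continuous_map_preimage[OF cont])
  next
    fix U assume U: "U \<subseteq> topspace (pi1_top ?Z (susp_base X))"
      and op: "openin ?M {w \<in> topspace ?M. (?cl \<circ> word_loop X) w \<in> U}"
    have "openin ?L {p \<in> topspace ?L. ?cl p \<in> U}"
    proof (subst openin_subopen, intro ballI)
      fix p assume "p \<in> {p \<in> topspace ?L. ?cl p \<in> U}"
      then have p: "p \<in> topspace ?L" "?cl p \<in> U" by auto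
      obtain n a b c s where nab: "n > 0" "0 < a" "a < b" "b < 1" and shape: "p \<in> loop_shape X n a b c s"
        by (rule loop_has_shape[OF p(1)])
      let ?N = "loop_shape X n a b c s"
      let ?T = "{p \<in> topspace (subtopology ?L ?N). loop_word n c s p \<in>
          {w \<in> topspace ?M. (?cl \<circ> word_loop X) w \<in> U}}"
      have NL: "?N \<subseteq> topspace ?L" by (auto simp: loop_shape_def)
      have "openin (subtopology ?L ?N) ?T"
        by (rule openin_continuous_map_preimage[OF continuous_map_loop_word op])
      then have "openin ?L ?T"
        using openin_loop_shape[OF nab] openin_trans_full by blast
      \<comment> \<open>By \<open>sect\<close>, a loop of this shape and the loop of its word have
        the same class, so membership in \<open>U\<close> can be tested on the word.\<close>
      moreover have "?T = {p \<in> ?N. ?cl p \<in> U}"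
        using sect[OF nab] NL by auto
      ultimately show "\<exists>T. openin ?L T \<and> p \<in> T \<and> T \<subseteq> {p \<in> topspace ?L. ?cl p \<in> U}"
        using shape p NL by (intro exI[of _ ?T]) auto
    qed
    then show "openin (pi1_top ?Z (susp_base X)) U"
      using q U by (simp add: quotient_map_def)
  qed
qed


section \<open>Words read off on a grid, and injectivity\<close>

text \<open>The letter contributed by a path with trace \<open>S\<close> from \<open>z\<close> to \<open>z'\<close> that stays inside
  \<open>X \<times> (0, 1)\<close>: it records whether and in which direction the level \<open>1/2\<close> is crossed.\<close>

definition grid_letter ::
    "'a topology \<Rightarrow> ('a option \<times> real) set set \<Rightarrow> ('a option \<times> real) set \<Rightarrow> ('a option \<times> real) set \<Rightarrow>
      (bool \<times> 'a set) list" where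
  "grid_letter X S z z' =
     (if S \<subseteq> susp_strip X \<and> (susp_lev z < 1/2) \<noteq> (susp_lev z' < 1/2)
      then [(susp_lev z < 1/2, path_component_of_set X (susp_pt z))] else [])"

definition grid_word :: "'a topology \<Rightarrow> nat \<Rightarrow> (real \<Rightarrow> ('a option \<times> real) set) \<Rightarrow> (bool \<times> 'a set) list" where
  "grid_word X n p =
     concat (map (\<lambda>i. grid_letter X (p ` grid_interval n i) (p (real i / real n)) (p (real (Suc i) / real n))) [0..<n])"

lemma grid_letter_base: "susp_base X \<in> S \<Longrightarrow> grid_letter X S z z' = []"
  by (auto simp: grid_letter_def)

text \<open>By connectedness, a trace in the strip with ends on different sides of 1/2 would have to
  meet the level 1/2.\<close>

lemma grid_letter_off:
  fixes f :: "'b::topological_space \<Rightarrow> ('a option \<times> real) set"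
  assumes f: "continuous_map (top_of_set C) (suspension_plus X) f" and C: "connected C"
    and off: "f ` C \<subseteq> susp_off X {1/2}" and uv: "u \<in> C" "v \<in> C"
  shows "grid_letter X (f ` C) (f u) (f v) = []"
proof (rule ccontr)
  assume "grid_letter X (f ` C) (f u) (f v) \<noteq> []"
  then have "f ` C \<subseteq> susp_strip X \<and> (susp_lev (f u) < 1/2) \<noteq> (susp_lev (f v) < 1/2)"
    unfolding grid_letter_def by presburger
  then have strip: "f ` C \<subseteq> susp_strip X" and ne: "(susp_lev (f u) < 1/2) \<noteq> (susp_lev (f v) < 1/2)"
    by (rule conjunct1, rule conjunct2)
  have "continuous_map (top_of_set C) (subtopology (suspension_plus X) (susp_strip X)) f"
    using f strip by (auto simp: continuous_map_in_subtopology)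
  from continuous_map_compose[OF this continuous_map_susp_lev]
  have "continuous_on C (susp_lev \<circ> f)" by simp
  then have conn: "connected ((susp_lev \<circ> f) ` C)" using C by (rule connected_continuous_image)
  have "1/2 \<in> (susp_lev \<circ> f) ` C"
  proof (cases "susp_lev (f u) < 1/2")
    case True
    show ?thesis by (rule connectedD_interval[OF conn, of "susp_lev (f u)" "susp_lev (f v)"]) (use True ne uv in auto)
  next
    case False
    show ?thesis by (rule connectedD_interval[OF conn, of "susp_lev (f v)" "susp_lev (f u)"]) (use False ne uv in auto)
  qed
  then obtain w where w: "w \<in> C" "susp_lev (f w) = 1/2" by (elim imageE) simp
  then have fw: "f w \<in> susp_strip X" "f w \<notin> susp_box (topspace X) {1/2}"
    using strip off w(1) unfolding susp_off_def by blast+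
  from fw(1) obtain x t where "f w = {(Some x, t)}" "x \<in> topspace X" by (elim susp_boxE)
  then show False using w(2) fw(2) by simp
qed

text \<open>The \<open>X\<close>-coordinate is continuous on the strip, so it carries a
  path-connected set into one path component. The component recorded by a letter can thus be read at
  any point of its piece.\<close>

lemma path_component_susp_pt:
  fixes f :: "'b::topological_space \<Rightarrow> ('a option \<times> real) set"
  assumes f: "continuous_map (top_of_set C) (suspension_plus X) f" and C: "path_connected C"
    and strip: "f ` C \<subseteq> susp_strip X" and uv: "u \<in> C" "v \<in> C"
  shows "path_component_of_set X (susp_pt (f u)) = path_component_of_set X (susp_pt (f v))"
proof -
  have "continuous_map (top_of_set C) (subtopology (suspension_plus X) (susp_strip X)) f"
    using f strip by (auto simp: continuous_map_in_subtopology)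
  from continuous_map_compose[OF this continuous_map_susp_pt]
  have g: "continuous_map (top_of_set C) X (susp_pt \<circ> f)" .
  have "path_connectedin (top_of_set C) C"
    using C by (simp add: path_connectedin_subtopology)
  from path_connectedin_continuous_map_image[OF g this]
  have "\<exists>h. pathin X h \<and> h \<in> {0..1} \<rightarrow> (susp_pt \<circ> f) ` C \<and> h 0 = (susp_pt \<circ> f) u \<and> h 1 = (susp_pt \<circ> f) v"
    unfolding path_connectedin by (elim conjE) (drule bspec[OF _ imageI[OF uv(1)]], erule bspec[OF _ imageI[OF uv(2)]])
  then have "path_component_of X ((susp_pt \<circ> f) u) ((susp_pt \<circ> f) v)"
    unfolding path_component_of_def by (elim exE conjE) (intro exI conjI)
  then show ?thesis
    by (intro Collect_cong) (metis comp_apply path_component_of_sym path_component_of_trans)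
qed

text \<open>Both routes around the square join the same two corners. In the strip all corners share
  one path component, so the reduced word of a route is determined by the sides of its two ends; off
  level 1/2 no edge contributes a letter.\<close>

lemma grid_square:
  assumes H: "continuous_map (top_of_set ({0..1} \<times> {0..1})) (suspension_plus X) H"
    and st: "0 \<le> s0" "s0 \<le> s1" "s1 \<le> 1" "0 \<le> t0" "t0 \<le> t1" "t1 \<le> (1::real)"
    and R: "H ` ({s0..s1} \<times> {t0..t1}) \<subseteq> susp_strip X \<or> H ` ({s0..s1} \<times> {t0..t1}) \<subseteq> susp_off X {1/2}"
  defines "L \<equiv> \<lambda>s::real. grid_letter X ((\<lambda>t. H (s, t)) ` {t0..t1}) (H (s, t0)) (H (s, t1))"
    and "M \<equiv> \<lambda>t. grid_letter X ((\<lambda>s. H (s, t)) ` {s0..s1}) (H (s0, t)) (H (s1, t))"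
  shows "reduce_word (L s0 @ M t1) = reduce_word (M t0 @ L s1)"
  using R
proof
  let ?R = "{s0..s1} \<times> {t0..t1}"
  assume strip: "H ` ?R \<subseteq> susp_strip X"
  have "?R \<subseteq> {0..1} \<times> {0..1}" using st by auto
  then have HR: "continuous_map (top_of_set ?R) (suspension_plus X) H"
    using continuous_map_from_subtopology_mono[OF H] by simp
  have "path_connected ?R" by (intro path_connected_Times) auto
  note comp = path_component_susp_pt[OF HR this strip]
  have sub: "(\<lambda>t. H (s, t)) ` {t0..t1} \<subseteq> susp_strip X" if "s \<in> {s0..s1}" for s
    using strip that by auto
  have sub': "(\<lambda>s. H (s, t)) ` {s0..s1} \<subseteq> susp_strip X" if "t \<in> {t0..t1}" for t
    using strip that by auto
  have "path_component_of_set X (susp_pt (H (s0, t1))) = path_component_of_set X (susp_pt (H (s0, t0)))"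
    "path_component_of_set X (susp_pt (H (s1, t0))) = path_component_of_set X (susp_pt (H (s0, t0)))"
    by (rule comp; use st in simp)+
  then show ?thesis
    unfolding L_def M_def grid_letter_def
    using sub[of s0] sub[of s1] sub'[of t0] sub'[of t1] st
    by (cases "susp_lev (H (s0, t0)) < 1/2"; cases "susp_lev (H (s0, t1)) < 1/2";
        cases "susp_lev (H (s1, t0)) < 1/2"; cases "susp_lev (H (s1, t1)) < 1/2")
      (simp_all add: reduce_word_def)
next
  assume off: "H ` ({s0..s1} \<times> {t0..t1}) \<subseteq> susp_off X {1/2}"
  have 1: "continuous_map (top_of_set {t0..t1}) (suspension_plus X) (\<lambda>t. H (s, t))" if "s \<in> {s0..s1}" for s
    by (rule continuous_map_compose[OF _ H, unfolded o_def])
      (use st that in \<open>auto simp: continuous_map_in_subtopology intro!: continuous_intros\<close>)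
  have 2: "continuous_map (top_of_set {s0..s1}) (suspension_plus X) (\<lambda>s. H (s, t))" if "t \<in> {t0..t1}" for t
    by (rule continuous_map_compose[OF _ H, unfolded o_def])
      (use st that in \<open>auto simp: continuous_map_in_subtopology intro!: continuous_intros\<close>)
  have "L s = []" if "s \<in> {s0..s1}" for s
    unfolding L_def
    by (rule grid_letter_off[OF 1[OF that] connected_Icc]) (use off that st in auto)
  moreover have "M t = []" if "t \<in> {t0..t1}" for t
    unfolding M_def
    by (rule grid_letter_off[OF 2[OF that] connected_Icc]) (use off that st in auto)
  ultimately show ?thesis using st by simp
qed

lemma reduce_word_append_cong:
  assumes "reduce_word u = reduce_word u'" "reduce_word v = reduce_word v'"
  shows "reduce_word (u @ v) = reduce_word (u' @ v')"
  by (metis assms reduce_word_append_left reduce_word_append_right)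

text \<open>The first coordinate is the homotopy time. The word is moved from one grid line to the
  next, square by square; the edges at loop times 0 and 1 touch the base point and contribute
  nothing.\<close>

lemma grid_word_homotopy:
  assumes H: "continuous_map (top_of_set ({0..1} \<times> {0..1})) (suspension_plus X) H"
    and base: "\<And>s. s \<in> {0..1} \<Longrightarrow> H (s, 0) = susp_base X \<and> H (s, 1) = susp_base X"
    and n: "n > 0"
    and fine: "\<And>i j. i < n \<Longrightarrow> j < n \<Longrightarrow>
        H ` (grid_interval n j \<times> grid_interval n i) \<subseteq> susp_strip X \<or>
        H ` (grid_interval n j \<times> grid_interval n i) \<subseteq> susp_off X {1/2}"
  shows "reduce_word (grid_word X n (\<lambda>t. H (0, t))) = reduce_word (grid_word X n (\<lambda>t. H (1, t)))"
proof -
  let ?s = "\<lambda>i. real i / real n"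
  let ?L = "\<lambda>j i. grid_letter X ((\<lambda>t. H (?s j, t)) ` grid_interval n i) (H (?s j, ?s i)) (H (?s j, ?s (Suc i)))"
  let ?M = "\<lambda>j i. grid_letter X ((\<lambda>s. H (s, ?s i)) ` grid_interval n j) (H (?s j, ?s i)) (H (?s (Suc j), ?s i))"
  have s: "0 \<le> ?s i" "?s i \<le> ?s (Suc i)" for i by (simp_all add: divide_right_mono)
  have s1: "?s i \<le> 1" if "i \<le> n" for i using that n by simp
  have sq: "reduce_word (?L j i @ ?M j (Suc i)) = reduce_word (?M j i @ ?L (Suc j) i)"
    if ij: "i < n" "j < n" for i j
    using grid_square[OF H s(1) s(2) s1 s(1) s(2) s1, of j i] fine[OF ij] ij
    by (simp only: grid_interval_def Suc_le_eq)
  have M0: "?M j i = []" if j: "j < n" and i: "?s i = 0 \<or> ?s i = 1" for i j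
  proof (rule grid_letter_base)
    have "?s j \<in> {0..1}" using s(1)[of j] s1[of j] j by simp
    then have "H (?s j, ?s i) = susp_base X" using base[of "?s j"] i by auto
    then show "susp_base X \<in> (\<lambda>s. H (s, ?s i)) ` grid_interval n j"
      using grid_interval_ends(1)[of j n] by (metis imageI)
  qed
  \<comment> \<open>Induction along the row: each further square moves the crossing edge from grid
    point \<open>i\<close> to \<open>Suc i\<close>.\<close>
  have row: "reduce_word (concat (map (?L j) [0..<i]) @ ?M j i) = reduce_word (concat (map (?L (Suc j)) [0..<i]))"
    if j: "j < n" and i: "i \<le> n" for i j
    using i
  proof (induction i)
    case 0
    then show ?case using M0[OF j, of 0] by simp
  next
    case (Suc i)
    let ?C = "concat (map (?L j) [0..<i])" and ?C' = "concat (map (?L (Suc j)) [0..<i])"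
    have "reduce_word (?C @ (?L j i @ ?M j (Suc i))) = reduce_word (?C @ (?M j i @ ?L (Suc j) i))"
      using Suc.prems j by (intro reduce_word_append_cong refl sq) auto
    also have "\<dots> = reduce_word (?C' @ ?L (Suc j) i)"
      unfolding append_assoc[symmetric] using Suc by (intro reduce_word_append_cong refl) auto
    finally show ?case by (simp del: of_nat_Suc)
  qed
  have step: "reduce_word (grid_word X n (\<lambda>t. H (?s j, t))) = reduce_word (grid_word X n (\<lambda>t. H (?s (Suc j), t)))"
    if j: "j < n" for j
    using row[OF j order_refl] M0[OF j, of n] n by (simp add: grid_word_def del: of_nat_Suc)
  have "reduce_word (grid_word X n (\<lambda>t. H (?s j, t))) = reduce_word (grid_word X n (\<lambda>t. H (0, t)))"
    if "j \<le> n" for j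
    using that by (induction j) (simp_all add: step[symmetric] del: of_nat_Suc)
  from this[of n] show ?thesis using n by simp
qed

section \<open>Grid words of the loops of words\<close>

lemma grid_word_cong:
  assumes "\<And>t. t \<in> {0..1} \<Longrightarrow> p t = q t"
  shows "grid_word X n p = grid_word X n q"
proof -
  have "p ` grid_interval n i = q ` grid_interval n i \<and> p (real i / real n) = q (real i / real n) \<and>
      p (real (Suc i) / real n) = q (real (Suc i) / real n)" if "i < n" for i
    using grid_interval_subset[OF that] grid_interval_ends[where n = n and i = i] assms
    by (intro conjI image_cong refl) blast+
  then show ?thesis
    unfolding grid_word_def by (intro arg_cong[of _ _ concat] map_cong refl) simp
qed

lemma grid_word_const: "grid_word X n (word_loop X []) = []"
proof -
  have "grid_word X n (word_loop X []) = grid_word X n (\<lambda>_. susp_base X)"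
    by (rule grid_word_cong) (simp add: word_loop_Nil)
  also have "\<dots> = []" by (auto simp: grid_word_def grid_letter_def)
  finally show ?thesis .
qed

text \<open>An even number of intervals makes 1/2 a grid point, and rescaling matches each half with
  the grid of \<open>k\<close> intervals.\<close>

lemma grid_word_loop_concat:
  assumes pq: "p 1 = q 0" and k: "k > 0"
  shows "grid_word X (2 * k) (loop_concat p q) = grid_word X k p @ grid_word X k q"
proof -
  let ?r = "loop_concat p q" and ?n = "real (2 * k)"
  let ?l = "\<lambda>n p i. grid_letter X (p ` grid_interval n i) (p (real i / real n)) (p (real (Suc i) / real n))"
  have first: "?l (2 * k) ?r i = ?l k p i" if i: "i < k" for i
  proof -
    have im: "(\<lambda>t. 2 * t) ` grid_interval (2 * k) i = grid_interval k i"
      using k by (simp add: grid_interval_def image_mult_atLeastAtMost del: of_nat_Suc)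
    have "real (Suc i) / ?n \<le> 1/2" using i k by (simp add: field_simps)
    then have r: "?r t = p (2 * t)" if "t \<in> grid_interval (2 * k) i" for t
    proof -
      have "0 \<le> real i / ?n" by simp
      then have "0 \<le> t" "t \<le> 1/2"
        using that \<open>real (Suc i) / ?n \<le> 1/2\<close> unfolding grid_interval_def atLeastAtMost_iff by linarith+
      then show ?thesis by (simp add: loop_concat_def)
    qed
    have "?r ` grid_interval (2 * k) i = p ` (\<lambda>t. 2 * t) ` grid_interval (2 * k) i"
      unfolding image_image by (rule image_cong[OF refl r])
    moreover have "?r (real i / ?n) = p (real i / real k)" "?r (real (Suc i) / ?n) = p (real (Suc i) / real k)"
      using r[OF grid_interval_ends(1)] r[OF grid_interval_ends(2)] by (simp_all del: of_nat_Suc)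
    ultimately show ?thesis by (simp only: im)
  qed
  have second: "?l (2 * k) ?r (k + i) = ?l k q i" if i: "i < k" for i
  proof -
    have im: "(\<lambda>t. 2 * t - 1) ` grid_interval (2 * k) (k + i) = grid_interval k i"
      using k by (simp add: grid_interval_def image_affinity_atLeastAtMost_diff add_divide_distrib)
    have "1/2 \<le> real (k + i) / ?n" using k by (simp add: field_simps)
    moreover have "grid_interval (2 * k) (k + i) \<subseteq> {0..1}" by (rule grid_interval_subset) (use i in simp)
    ultimately have "1/2 \<le> t \<and> t \<le> 1" if "t \<in> grid_interval (2 * k) (k + i)" for t
      using that unfolding grid_interval_def by (meson atLeastAtMost_iff order_trans subsetD)
    \<comment> \<open>At \<open>t = 1/2\<close> the concatenation takes the value
      \<open>p 1\<close>, which is \<open>q 0\<close> by assumption.\<close>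
    moreover have "?r t = q (2 * t - 1)" if "1/2 \<le> t \<and> t \<le> 1" for t
    proof (cases "t = 1/2")
      case True
      show ?thesis unfolding True using pq by (simp add: loop_concat_def)
    next
      case False
      then show ?thesis using that by (simp add: loop_concat_def)
    qed
    ultimately have r: "?r t = q (2 * t - 1)" if "t \<in> grid_interval (2 * k) (k + i)" for t
      using that by blast
    have "?r ` grid_interval (2 * k) (k + i) = q ` (\<lambda>t. 2 * t - 1) ` grid_interval (2 * k) (k + i)"
      unfolding image_image by (rule image_cong[OF refl r])
    moreover have "2 * (real (k + i) / ?n) - 1 = real i / real k"
      "2 * (real (Suc (k + i)) / ?n) - 1 = real (Suc i) / real k"
      using k by (simp_all add: field_simps)
    then have "?r (real (k + i) / ?n) = q (real i / real k)"
      "?r (real (Suc (k + i)) / ?n) = q (real (Suc i) / real k)"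
      using r[OF grid_interval_ends(1)] r[OF grid_interval_ends(2)] by (simp_all only:)
    ultimately show ?thesis by (simp only: im)
  qed
  have "[0..<2 * k] = [0..<k] @ map (\<lambda>i. k + i) [0..<k]"
    using upt_add_eq_append[of 0 k k] map_add_upt[of k k] by (simp add: mult_2 add.commute)
  then have "grid_word X (2 * k) ?r = concat (map (?l (2 * k) ?r) [0..<k]) @ concat (map (\<lambda>i. ?l (2 * k) ?r (k + i)) [0..<k])"
    by (simp only: grid_word_def map_append concat_append map_map o_def)
  also have "map (?l (2 * k) ?r) [0..<k] = map (?l k p) [0..<k]"
    by (rule map_cong[OF refl]) (simp only: first set_upt atLeastLessThan_iff)
  also have "map (\<lambda>i. ?l (2 * k) ?r (k + i)) [0..<k] = map (?l k q) [0..<k]"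
    by (rule map_cong[OF refl]) (simp only: second set_upt atLeastLessThan_iff)
  finally show ?thesis by (simp only: grid_word_def)
qed

lemma concat_map_single:
  assumes "j < n" "\<And>i. i < n \<Longrightarrow> i \<noteq> j \<Longrightarrow> f i = []"
  shows "concat (map f [0..<n]) = f j"
  using assms
proof (induction n)
  case (Suc n)
  show ?case
  proof (cases "j = n")
    case True
    then have "concat (map f [0..<n]) = []" using Suc.prems(2) by auto
    then show ?thesis using True by simp
  qed (use Suc in simp)
qed simp

text \<open>The level is monotone and passes 1/2 in a single interval. With at least three intervals
  this is neither the first nor the last, which touch the base point and give no letter.\<close>

lemma grid_word_letter_loop:
  assumes x: "x \<in> topspace X" and n: "n \<ge> 3"
  shows "grid_word X n (letter_loop X (e, x)) = [(e, path_component_of_set X x)]"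
proof -
  let ?p = "letter_loop X (e, x)"
  let ?l = "\<lambda>i. grid_letter X (?p ` grid_interval n i) (?p (real i / real n)) (?p (real (Suc i) / real n))"
  define m where "m t = (if e then t else 1 - t)" for t :: real
  have p01: "?p 0 = susp_base X" "?p 1 = susp_base X"
    using loop_ends[OF letter_loop_in[OF x]] by auto
  have p: "?p t = {(Some x, m t)}" if "0 < t" "t < 1" for t
    using that by (auto simp: letter_loop_def m_def susp_proj_inner)
  have inner: "0 < real i / real n \<and> real (Suc i) / real n < 1" if "0 < i" "Suc i < n" for i
    using that n by (simp del: of_nat_Suc)
  \<comment> \<open>The last grid index before the crossing. Level 1/2 itself counts as the upper
    side, so a rising loop takes the last \<open>i\<close> with \<open>2 * i < n\<close>, a falling
    one the last with \<open>2 * i <= n\<close>.\<close>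
  define j where "j = (if e then (n - 1) div 2 else n div 2)"
  have j: "0 < j" "Suc j < n" using n by (auto simp: j_def)
  have lt: "real i / real n < 1/2 \<longleftrightarrow> 2 * i < n" for i
  proof -
    have "real i / real n < 1/2 \<longleftrightarrow> real (2 * i) < real n" using n by (simp add: field_simps)
    then show ?thesis by (simp only: of_nat_less_iff)
  qed
  have gt: "1 - real i / real n < 1/2 \<longleftrightarrow> n < 2 * i" for i
  proof -
    have "1 - real i / real n < 1/2 \<longleftrightarrow> real n < real (2 * i)" using n by (simp add: field_simps)
    then show ?thesis by (simp only: of_nat_less_iff)
  qed
  have cross: "(m (real i / real n) < 1/2) \<noteq> (m (real (Suc i) / real n) < 1/2) \<longleftrightarrow> i = j" if "i < n" for i
  proof (cases e)
    case True
    then have m: "m (real i / real n) < 1/2 \<longleftrightarrow> 2 * i < n" for i by (simp only: m_def if_True lt)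
    show ?thesis unfolding m using True that by (simp add: j_def) arith
  next
    case False
    then have m: "m (real i / real n) < 1/2 \<longleftrightarrow> n < 2 * i" for i by (simp only: m_def if_False gt)
    show ?thesis unfolding m using False that by (simp add: j_def) arith
  qed
  have letter: "?l i = (if i = j then [(m (real i / real n) < 1/2, path_component_of_set X x)] else [])"
    if i: "i < n" for i
  proof (cases "0 < i \<and> Suc i < n")
    case True
    then have io: "0 < real i / real n" "real (Suc i) / real n < 1" using inner by auto
    have le: "real i / real n \<le> real (Suc i) / real n" by (simp add: divide_right_mono)
    have t: "0 < t \<and> t < 1" if "t \<in> grid_interval n i" for t
      using that io unfolding grid_interval_def by simp
    have "?p ` grid_interval n i \<subseteq> susp_strip X"
    proof (intro image_subsetI)
      fix t assume "t \<in> grid_interval n i"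
      from t[OF this] show "?p t \<in> susp_strip X" using p[of t] x by (simp add: m_def)
    qed
    then show ?thesis
      using cross[OF i] p[of "real i / real n"] p[of "real (Suc i) / real n"] io le
      by (simp add: grid_letter_def del: of_nat_Suc)
  next
    case False
    have "real i / real n = 0 \<or> real (Suc i) / real n = 1" using False i n by auto
    then have "susp_base X \<in> ?p ` grid_interval n i"
      using p01 grid_interval_ends[where n = n and i = i] by (metis imageI)
    moreover have "i \<noteq> j" using False j by auto
    ultimately show ?thesis by (simp add: grid_letter_base)
  qed
  have "m (real j / real n) < 1/2 \<longleftrightarrow> e"
  proof (cases e)
    case True
    have "2 * j < n" using n True by (simp add: j_def)
    then show ?thesis using True by (simp add: m_def lt)
  next
    case False
    have "2 * j \<le> n" using n False by (simp add: j_def)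
    then show ?thesis using False gt[of j] by (simp add: m_def)
  qed
  moreover have "grid_word X n ?p = ?l j"
    unfolding grid_word_def by (rule concat_map_single) (use j letter in auto)
  ultimately show ?thesis using letter[of j] j by simp
qed

text \<open>All multiples of \<open>m\<close> are covered, so that two words can be read on a
  common, arbitrarily fine grid.\<close>

lemma grid_word_word_loop:
  assumes "w \<in> lists (UNIV \<times> topspace X)"
  shows "\<exists>m>0. \<forall>k>0. grid_word X (m * k) (word_loop X w) = word_path_components X w"
  using assms
proof (induction w)
  case Nil
  then show ?case by (intro exI[of _ 1]) (simp add: grid_word_const)
next
  case (Cons a w)
  obtain e x where a: "a = (e, x)" by fastforce
  have x: "x \<in> topspace X" and w: "w \<in> lists (UNIV \<times> topspace X)" using Cons a by auto
  obtain m where m: "m > 0" "\<And>k. k > 0 \<Longrightarrow> grid_word X (m * k) (word_loop X w) = word_path_components X w"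
    using Cons.IH by blast
  \<comment> \<open>The factor 2 accounts for the concatenation; the factor 3 gives the letter loop
    at least three intervals.\<close>
  have "grid_word X (6 * m * k) (word_loop X (a # w)) = word_path_components X (a # w)" if k: "k > 0" for k
  proof -
    let ?n = "m * (3 * k)"
    have "1 * 1 \<le> m * k" by (rule mult_le_mono) (use m(1) k in auto)
    then have n: "3 \<le> ?n" by simp
    have "6 * m * k = 2 * ?n" by simp
    moreover have "letter_loop X a 1 = word_loop X w 0"
      using loop_ends[OF letter_loop_in[OF x]] loop_ends[OF word_loop_in[OF w]] by (simp add: a)
    ultimately have "grid_word X (6 * m * k) (word_loop X (a # w)) =
        grid_word X ?n (letter_loop X a) @ grid_word X ?n (word_loop X w)"
      using n by (simp only: word_loop_Cons) (intro grid_word_loop_concat; simp)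
    then show ?thesis
      using grid_word_letter_loop[OF x n, of e] m(2)[of "3 * k"] k by (simp add: a)
  qed
  then show ?case using m(1) by (intro exI[of _ "6 * m"]) simp
qed

lemma diameter_grid_square:
  assumes "n > 0"
  shows "diameter (grid_interval n j \<times> grid_interval n i) \<le> 2 / real n"
proof (rule diameter_le)
  have d: "\<bar>u - v\<bar> \<le> 1 / real n" if "u \<in> grid_interval n k" "v \<in> grid_interval n k" for u v k
  proof -
    have "real (Suc k) / real n = real k / real n + 1 / real n" by (simp add: add_divide_distrib)
    then show ?thesis using that unfolding grid_interval_def by (simp add: abs_le_iff del: of_nat_Suc)
  qed
  fix y z assume yz: "y \<in> grid_interval n j \<times> grid_interval n i" "z \<in> grid_interval n j \<times> grid_interval n i"
  have "norm (y - z) \<le> norm (fst (y - z)) + norm (snd (y - z))"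
    using norm_Pair_le[of "fst (y - z)" "snd (y - z)"] by (simp only: prod.collapse)
  also have "\<dots> \<le> 1 / real n + 1 / real n"
    using yz by (intro add_mono) (auto intro!: d)
  finally show "norm (y - z) \<le> 2 / real n" by simp
qed simp

lemma reduce_word_eq_if_loop_class_eq:
  assumes v: "v \<in> lists (UNIV \<times> topspace X)" and w: "w \<in> lists (UNIV \<times> topspace X)"
    and eq: "loop_class (suspension_plus X) (susp_base X) (word_loop X v) =
      loop_class (suspension_plus X) (susp_base X) (word_loop X w)"
  shows "reduce_word (word_path_components X v) = reduce_word (word_path_components X w)"
proof -
  let ?Z = "suspension_plus X" and ?S = "{0..1} \<times> {0..1} :: (real \<times> real) set"
  have "loop_homotopic ?Z (susp_base X) (word_loop X v) (word_loop X w)"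
    using eq by (simp add: loop_class_eq_iff word_loop_in v w del: in_lists_conv_set)
  then obtain H where H: "continuous_map (top_of_set ?S) ?Z H"
    and Hv: "\<And>s. s \<in> {0..1} \<Longrightarrow> H (0, s) = word_loop X v s"
    and Hw: "\<And>s. s \<in> {0..1} \<Longrightarrow> H (1, s) = word_loop X w s"
    and base: "\<And>s. s \<in> {0..1} \<Longrightarrow> H (s, 0) = susp_base X \<and> H (s, 1) = susp_base X"
    unfolding loop_homotopic_iff prod_topology_subtopology_eu by blast
  obtain mv where mv: "mv > 0" "\<And>k. k > 0 \<Longrightarrow> grid_word X (mv * k) (word_loop X v) = word_path_components X v"
    using grid_word_word_loop[OF v] by blast
  obtain mw where mw: "mw > 0" "\<And>k. k > 0 \<Longrightarrow> grid_word X (mw * k) (word_loop X w) = word_path_components X w"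
    using grid_word_word_loop[OF w] by blast
  have J: "{1/2} \<subseteq> {0<..<1::real}" by auto
  have strip: "openin ?Z (susp_strip X)" by (rule openin_susp_box) auto
  have off: "openin ?Z (susp_off X {1/2})" using J by (intro openin_susp_off) auto
  have "compact ?S" by (intro compact_Times) auto
  from Lebesgue_two_sets[OF this H strip off topspace_susp_strip_off[OF J]]
  obtain \<delta> where \<delta>: "\<delta> > 0" "\<And>T. T \<subseteq> ?S \<Longrightarrow> diameter T < \<delta> \<Longrightarrow>
      H ` T \<subseteq> susp_strip X \<or> H ` T \<subseteq> susp_off X {1/2}" by metis
  obtain N where N: "inverse (real (Suc N)) < \<delta> / 2" using reals_Archimedean[of "\<delta> / 2"] \<delta>(1) by auto
  \<comment> \<open>A common multiple of \<open>mv\<close> and \<open>mw\<close>, so that both grid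
    words are known, and at least \<open>Suc N\<close>, so that the squares are small
    enough.\<close>
  let ?n = "mv * (mw * Suc N)"
  have n: "?n > 0" using mv(1) mw(1) by simp
  have "1 * 1 \<le> mv * mw" by (rule mult_le_mono) (use mv(1) mw(1) in auto)
  then have "1 * Suc N \<le> (mv * mw) * Suc N" by (intro mult_le_mono1) simp
  then have "real (Suc N) \<le> real ?n" by (simp only: of_nat_le_iff mult_1 mult.assoc)
  then have "2 / real ?n \<le> 2 * inverse (real (Suc N))"
    by (simp only: divide_inverse) (intro mult_left_mono le_imp_inverse_le; simp)
  then have small: "2 / real ?n < \<delta>" using N by linarith
  have "reduce_word (grid_word X ?n (\<lambda>t. H (0, t))) = reduce_word (grid_word X ?n (\<lambda>t. H (1, t)))"
  proof (rule grid_word_homotopy[OF H base n])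
    fix i j assume ij: "i < ?n" "j < ?n"
    show "H ` (grid_interval ?n j \<times> grid_interval ?n i) \<subseteq> susp_strip X \<or>
        H ` (grid_interval ?n j \<times> grid_interval ?n i) \<subseteq> susp_off X {1/2}"
    proof (rule \<delta>(2))
      show "grid_interval ?n j \<times> grid_interval ?n i \<subseteq> ?S"
        by (intro Sigma_mono grid_interval_subset ij)
      show "diameter (grid_interval ?n j \<times> grid_interval ?n i) < \<delta>"
        using diameter_grid_square[OF n] small by (rule le_less_trans)
    qed
  qed
  moreover have "grid_word X ?n (\<lambda>t. H (0, t)) = word_path_components X v"
    using grid_word_cong[OF Hv, where n = ?n] mv(2)[of "mw * Suc N"] mw(1) by simp
  moreover have "grid_word X ?n (\<lambda>t. H (1, t)) = word_path_components X w"
  proof -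
    have "?n = mw * (mv * Suc N)" by (simp only: mult.left_commute)
    then have "grid_word X ?n (word_loop X w) = word_path_components X w"
      using mw(2)[of "mv * Suc N"] mv(1) by (simp only: nat_0_less_mult_iff zero_less_Suc simp_thms)
    then show ?thesis by (simp only: grid_word_cong[OF Hw])
  qed
  ultimately show ?thesis by simp
qed

theorem theorem2p28:
  fixes X :: "'a topology"
  shows "susp_hom X \<in> iso (free_group (path_components_of X))
                          (pi1 (suspension_plus X) (susp_base X)) \<and>
         homeomorphic_map (free_group_top X)
                          (pi1_top (suspension_plus X) (susp_base X)) (susp_hom X)"
proof -
  let ?Z = "suspension_plus X" and ?M = "free_monoid_top X"
  let ?cl = "loop_class ?Z (susp_base X)"
  let ?G = "free_group (path_components_of X)"
  let ?R = "\<lambda>w. reduce_word (word_path_components X w)"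
  \<comment> \<open>The projection of words onto the topologized free group, in two quotient steps;
    on a word it is the reduction of its word of path components.\<close>
  let ?q = "reduce_word \<circ> word_components X \<circ> path_component_of_set ?M"
  have q: "quotient_map ?M (free_group_top X) ?q"
    unfolding free_group_top_def pi0_top_def
    by (rule quotient_map_compose[OF quotient_map_quotient_topology quotient_map_quotient_topology])
  have q_eq: "?q w = ?R w" if "w \<in> topspace ?M" for w
    using word_components_path_component[OF that] by simp
  have carrier: "carrier ?G = ?R ` topspace ?M"
    using q q_eq unfolding topspace_free_group_top[symmetric] quotient_map_def by (metis (no_types, lifting) image_cong)
  have hom_R: "susp_hom X (?R w) = ?cl (word_loop X w)" if "w \<in> topspace ?M" for w
    using that word_path_components_lists[of w X]
    by (simp add: topspace_free_monoid_top susp_hom_reduce_word loop_class_word_loop del: in_lists_conv_set)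
  \<comment> \<open>Composed with \<open>?q\<close>, the homomorphism sends a word to the class of
    its loop, which is known to be a quotient map; hence \<open>susp_hom X\<close> is one as
    well.\<close>
  have "quotient_map ?M (pi1_top ?Z (susp_base X)) (susp_hom X \<circ> ?q)"
    by (rule quotient_map_eq[OF quotient_map_loop_class_word_loop])
      (simp only: o_apply q_eq[unfolded o_apply] hom_R)
  then have quot: "quotient_map (free_group_top X) (pi1_top ?Z (susp_base X)) (susp_hom X)"
    using quotient_map_compose_eq[OF q] by blast
  \<comment> \<open>Elements of the free group are represented by words over \<open>X\<close>, for
    which equal loop classes force equal reduced words.\<close>
  have inj: "inj_on (susp_hom X) (carrier ?G)"
  proof (rule inj_onI)
    fix g h assume gh: "g \<in> carrier ?G" "h \<in> carrier ?G" "susp_hom X g = susp_hom X h"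
    then obtain v w where v: "v \<in> topspace ?M" "g = ?R v" and w: "w \<in> topspace ?M" "h = ?R w"
      unfolding carrier by blast
    then have "?cl (word_loop X v) = ?cl (word_loop X w)"
      using gh(3) hom_R by metis
    then show "g = h"
      using reduce_word_eq_if_loop_class_eq[of v X w] v w by (simp only: topspace_free_monoid_top)
  qed
  have "susp_hom X ` carrier ?G = carrier (susp_pi1 X)"
    using quot by (simp add: quotient_map_def topspace_free_group_top topspace_pi1_top)
  then have "susp_hom X \<in> iso ?G (susp_pi1 X)"
    using inj susp_hom_hom[of X] by (simp add: iso_def bij_betw_def)
  moreover have "homeomorphic_map (free_group_top X) (pi1_top ?Z (susp_base X)) (susp_hom X)"
    using quot inj by (simp add: homeomorphic_map_def topspace_free_group_top)
  ultimately show ?thesis by blast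
qed

end
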